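(* Let $(a,b,c,\lambda,\delta)\in(\mathbb F^\times)^4\times\mathbb F$. The $\triangle_q$-module $W_\lambda^\delta(a,b,c)$ is reducible if and only if there exists an integer $i$ with $0\le i\le d'-1$ such that (i) there is $\mu\in\mathbb F^\times$ with $Ae_i=(\mu+\mu^{-1})e_i$ and $e_i$ an eigenvector of $(A-\mu q^2-\mu^{-1}q^{-2})B$ on $W_\lambda^\delta(a,b,c)$ (that is, $e_i$ is a marginal weight vector of the module $W_\lambda^\delta(a,b,c)$ twisted by the automorphism exchanging $A$ and $B$), and (ii) $L^{(i)}=0$, where $L^{(i)}$ is the coefficient of $w_0$ in $\prod_{h=1}^{d'-1}(B-\theta^*_{d'-h})e_i$ with respect to the basis $\{w_h\}_{h=0}^{d'-1}$.
   Context: $\mathbb F$ is an algebraically closed field and $q\in\mathbb F^\times$ a root of unity of order $d\notin\{1,2,4\}$; $d'=d$ if $d$ odd, $d'=d/2$ if $d$ even. $\triangle_q$ is the unital associative $\mathbb F$-algebra with generators $A,B,C$ subject to: each of $A+\frac{qBC-q^{-1}CB}{q^2-q^{-2}}$, $B+\frac{qCA-q^{-1}AC}{q^2-q^{-2}}$, $C+\frac{qAB-q^{-1}BA}{q^2-q^{-2}}$ is central; $\alpha,\beta,\gamma$ are these times $q+q^{-1}$. For $(a,b,c,\lambda)\in(\mathbb F^\times)^4$, $i\in\mathbb N$: $\theta_i=a\lambda^{-1}q^{2i}+a^{-1}\lambda q^{-2i}$, $\theta_i^*=b\lambda^{-1}q^{2i}+b^{-1}\lambda q^{-2i}$, $\varphi_i=a^{-1}b^{-1}\lambda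 q(q^i-q^{-i})(\lambda^{-1}q^{i-1}-\lambda q^{1-i})(q^{-i}-abc\lambda^{-1}q^{i-1})(q^{-i}-abc^{-1}\lambda^{-1}q^{i-1})$. $M_\lambda(a,b,c)$ has basis $\{m_i\}_{i\in\mathbb N}$, $(A-\theta_i)m_i=m_{i+1}$, $(B-\theta_i^* )m_i=\varphi_im_{i-1}$, $\alpha,\beta,\gamma$ acting as $(b+b^{-1})(c+c^{-1})+(a+a^{-1})(\lambda q+\lambda^{-1}q^{-1})$, $(c+c^{-1})(a+a^{-1})+(b+b^{-1})(\lambda q+\lambda^{-1}q^{-1})$, $(a+a^{-1})(b+b^{-1})+(c+c^{-1})(\lambda q+\lambda^{-1}q^{-1})$. $W_\lambda^\delta(a,b,c)$ is the quotient of $M_\lambda(a,b,c)$ by the span of $\{\delta m_i-m_{d'+i}\}_{i\in\mathbb N}$; $w_i$ is the image of $m_i$, and $\{w_i\}_{i=0}^{d'-1}$ is a basis. Fix $\nu\in\mathbb F^\times$ with $\nu^{d'}+\nu^{-d'}=\delta+a^{d'}\lambda^{-d'}+a^{-d'}\lambda^{d'}$, set $\vartheta_i=\nu^{-1}q^{2i}+\nu q^{-2i}$ and, for $0\le i\le d'-1$, $e_i=\sum_{h=1}^{d'}\prod_{j=h}^{d'-1}(\vartheta_i-\theta_j)\,w_{h-1}\in W_\lambda^\delta(a,b,c)$. *)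

theory Defs
  imports Main "HOL-Computational_Algebra.Polynomial"
begin

definition alg_closed :: "'a::field itself \<Rightarrow> bool" where
  "alg_closed _ \<longleftrightarrow> (\<forall>p::'a poly. 0 < degree p \<longrightarrow> (\<exists>x. poly p x = 0))"

definition root_of_unity_order :: "'a::field \<Rightarrow> nat \<Rightarrow> bool" where
  "root_of_unity_order q d \<longleftrightarrow> 0 < d \<and> q ^ d = 1 \<and> (\<forall>k. 0 < k \<and> k < d \<longrightarrow> q ^ k \<noteq> 1)"

definition dprime :: "nat \<Rightarrow> nat" where
  "dprime d = (if odd d then d else d div 2)"

definition theta :: "'a::field \<Rightarrow> 'a \<Rightarrow> 'a \<Rightarrow> nat \<Rightarrow> 'a" where
  "theta q a l i = a * inverse l * q powi (2 * int i) + inverse a * l * q powi (- 2 * int i)"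

definition theta_s :: "'a::field \<Rightarrow> 'a \<Rightarrow> 'a \<Rightarrow> nat \<Rightarrow> 'a" where
  "theta_s q b l i = b * inverse l * q powi (2 * int i) + inverse b * l * q powi (- 2 * int i)"

definition phi :: "'a::field \<Rightarrow> 'a \<Rightarrow> 'a \<Rightarrow> 'a \<Rightarrow> 'a \<Rightarrow> nat \<Rightarrow> 'a" where
  "phi q a b c l i = inverse a * inverse b * l * q
     * (q powi int i - q powi (- int i))
     * (inverse l * q powi (int i - 1) - l * q powi (1 - int i))
     * (q powi (- int i) - a * b * c * inverse l * q powi (int i - 1))
     * (q powi (- int i) - a * b * inverse c * inverse l * q powi (int i - 1))"

text \<open>Eigenvalue of the central element gamma on the module.\<close>
definition gamma_val :: "'a::field \<Rightarrow> 'a \<Rightarrow> 'a \<Rightarrow> 'a \<Rightarrow> 'a \<Rightarrow> 'a" where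
  "gamma_val q a b c l = (a + inverse a) * (b + inverse b) + (c + inverse c) * (l * q + inverse l * inverse q)"

text \<open>Vectors of W = W_lambda^delta(a,b,c) are represented by their coordinate functions
  with respect to the basis w_0, ..., w_{d'-1}: a vector v stands for the sum of v k * w_k
  over k < d', and v k = 0 for k >= d'.\<close>
definition Wvecs :: "nat \<Rightarrow> (nat \<Rightarrow> 'a::field) set" where
  "Wvecs n = {v. \<forall>k\<ge>n. v k = 0}"

text \<open>Action of A on W (n = d'): A w_k = theta_k w_k + w_{k+1}, with w_{d'} = delta w_0.\<close>
definition actA :: "'a::field \<Rightarrow> 'a \<Rightarrow> 'a \<Rightarrow> 'a \<Rightarrow> nat \<Rightarrow> (nat \<Rightarrow> 'a) \<Rightarrow> nat \<Rightarrow> 'a" where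
  "actA q a l \<delta> n v k =
     (if k < n then theta q a l k * v k + (if k = 0 then \<delta> * v (n - 1) else v (k - 1)) else 0)"

text \<open>Action of B on W: B w_k = theta*_k w_k + phi_k w_{k-1}.\<close>
definition actB :: "'a::field \<Rightarrow> 'a \<Rightarrow> 'a \<Rightarrow> 'a \<Rightarrow> 'a \<Rightarrow> nat \<Rightarrow> (nat \<Rightarrow> 'a) \<Rightarrow> nat \<Rightarrow> 'a" where
  "actB q a b c l n v k =
     (if k < n then theta_s q b l k * v k + (if k + 1 < n then phi q a b c l (k + 1) * v (k + 1) else 0) else 0)"

text \<open>Action of C on W, determined by the centrality of C + (qAB - q^{-1}BA)/(q^2-q^{-2}),
  which acts as gamma/(q+q^{-1}).\<close>
definition actC :: "'a::field \<Rightarrow> 'a \<Rightarrow> 'a \<Rightarrow> 'a \<Rightarrow> 'a \<Rightarrow> 'a \<Rightarrow> nat \<Rightarrow> (nat \<Rightarrow> 'a) \<Rightarrow> nat \<Rightarrow> 'a" where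
  "actC q a b c l \<delta> n v k =
     gamma_val q a b c l / (q + inverse q) * v k
     - (q * actA q a l \<delta> n (actB q a b c l n v) k
        - inverse q * actB q a b c l n (actA q a l \<delta> n v) k) / (q^2 - inverse q ^ 2)"

definition W_submodule :: "'a::field \<Rightarrow> 'a \<Rightarrow> 'a \<Rightarrow> 'a \<Rightarrow> 'a \<Rightarrow> 'a \<Rightarrow> nat \<Rightarrow> (nat \<Rightarrow> 'a) set \<Rightarrow> bool" where
  "W_submodule q a b c l \<delta> n U \<longleftrightarrow>
     U \<subseteq> Wvecs n \<and> (\<lambda>_. 0) \<in> U
     \<and> (\<forall>u\<in>U. \<forall>v\<in>U. (\<lambda>k. u k + v k) \<in> U)
     \<and> (\<forall>s. \<forall>u\<in>U. (\<lambda>k. s * u k) \<in> U)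
     \<and> (\<forall>u\<in>U. actA q a l \<delta> n u \<in> U)
     \<and> (\<forall>u\<in>U. actB q a b c l n u \<in> U)
     \<and> (\<forall>u\<in>U. actC q a b c l \<delta> n u \<in> U)"

definition W_reducible :: "'a::field \<Rightarrow> 'a \<Rightarrow> 'a \<Rightarrow> 'a \<Rightarrow> 'a \<Rightarrow> 'a \<Rightarrow> nat \<Rightarrow> bool" where
  "W_reducible q a b c l \<delta> n \<longleftrightarrow>
     (\<exists>U. W_submodule q a b c l \<delta> n U \<and> U \<noteq> {\<lambda>_. 0} \<and> U \<noteq> Wvecs n)"

definition vartheta :: "'a::field \<Rightarrow> 'a \<Rightarrow> nat \<Rightarrow> 'a" where
  "vartheta q \<nu> i = inverse \<nu> * q powi (2 * int i) + \<nu> * q powi (- 2 * int i)"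

definition evec :: "'a::field \<Rightarrow> 'a \<Rightarrow> 'a \<Rightarrow> 'a \<Rightarrow> nat \<Rightarrow> nat \<Rightarrow> nat \<Rightarrow> 'a" where
  "evec q a l \<nu> n i k =
     (\<Sum>h=1..n. (if k = h - 1 then (\<Prod>j=h..n-1. vartheta q \<nu> i - theta q a l j) else 0))"

text \<open>Bprod m v = (B - theta*_{d'-m}) ... (B - theta*_{d'-1}) v; for m = d'-1 this is
  prod_{h=1}^{d'-1} (B - theta*_{d'-h}) v (the factors commute).\<close>
fun Bprod :: "'a::field \<Rightarrow> 'a \<Rightarrow> 'a \<Rightarrow> 'a \<Rightarrow> 'a \<Rightarrow> nat \<Rightarrow> nat \<Rightarrow> (nat \<Rightarrow> 'a) \<Rightarrow> nat \<Rightarrow> 'a" where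
  "Bprod q a b c l n 0 v = v"
| "Bprod q a b c l n (Suc m) v =
     (\<lambda>k. actB q a b c l n (Bprod q a b c l n m v) k - theta_s q b l (n - Suc m) * Bprod q a b c l n m v k)"

end

theory Submission
  imports Defs "HOL-Library.Function_Algebras"
begin

text \<open>
  The proof only uses two Askey-Wilson type relations between A and B, one quadratic in A and one
  quadratic in B. If e is marginal and the coefficient L vanishes, the fewer than n vectors
  (B - theta*_{n-k}) ... (B - theta*_{n-1}) e with k < n - 1 span a B-invariant space, and the
  relation quadratic in B shows by induction that A preserves it.

  Conversely, W is identified with F[x]/(chi), where A is multiplication by x and chi is the
  characteristic polynomial; its roots are th (u i), where th y = y + 1/y and u i runs through a
  coset of the powers of q^2. A proper nonzero submodule U is an ideal (g) with chi = g h, both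
  factors being non-units. The relation quadratic in A, applied to an eigenvector with eigenvalue
  th y, says that B moves it to the eigenvalues th (y q^2) and th (y / q^2), so in the absence of
  marginal vectors in U the roots of h propagate along the whole coset. If chi has only simple
  roots this makes g a unit. Otherwise the coset is stable under y -> 1/y; counting multiplicities,
  the roots of g propagate as well, which is impossible at a root with y = 1/y (it is simple) and at
  a root with y = q^2/y (where the neighbour is the root itself). A marginal vector of U has L = 0,
  because otherwise w_0, which generates W, would lie in U.
\<close>

section \<open>The two relations between A and B\<close>

text \<open>With \<open>x = q^(2k)\<close>, \<open>t = a/l\<close>, \<open>s = b/l\<close>, the
  functions \<open>T\<close>, \<open>S\<close>, \<open>F\<close> are theta_k, theta*_k, phi_k. This
  makes the coefficient of \<open>v (k - 1)\<close> vanish in the relation quadratic in A, read at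
  coordinate \<open>k\<close>; in the relation quadratic in B it serves for
  \<open>v (k + 1)\<close>.\<close>

lemma lower_coefficient_identity:
  fixes q t s l c x :: "'a::field"
  assumes "q \<noteq> 0" "t \<noteq> 0" "s \<noteq> 0" "l \<noteq> 0" "c \<noteq> 0" "x \<noteq> 0"
  defines "T \<equiv> \<lambda>x. t * x + 1 / (t * x)" and "S \<equiv> \<lambda>x. s * x + 1 / (s * x)"
    and "F \<equiv> \<lambda>x. q / (s * t * l) / x^2 * (x - 1) * (x / (l * q) - l * q)
                 * (1 - s * t * l * c * x / q) * (1 - s * t * l * x / (c * q))"
    and "Q \<equiv> q^2 + 1 / q^2"
    and "g \<equiv> (t * l + 1 / (t * l)) * (s * l + 1 / (s * l)) + (c + 1 / c) * (l * q + 1 / (l * q))"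
  shows "F (x / q^2) - Q * F x + F (x * q^2) + (T x + T (x / q^2)) * (S x + S (x / q^2))
          - Q * (T x * S x + T (x / q^2) * S (x / q^2)) + (q - 1 / q)^2 * g = 0"
  using assms(1-6) unfolding T_def S_def F_def Q_def g_def
  apply (simp add: divide_simps)
  apply algebra
  done

text \<open>Handles the coefficient of \<open>v k\<close>. As \<open>F\<close> is symmetric in
  \<open>s\<close> and \<open>t\<close>, exchanging these letters gives the identity for the other
  relation.\<close>

lemma diagonal_coefficient_identity:
  fixes q t s l c x :: "'a::field"
  assumes "q \<noteq> 0" "t \<noteq> 0" "s \<noteq> 0" "l \<noteq> 0" "c \<noteq> 0" "x \<noteq> 0"
  defines "T \<equiv> \<lambda>x. t * x + 1 / (t * x)" and "S \<equiv> \<lambda>x. s * x + 1 / (s * x)"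
    and "F \<equiv> \<lambda>x. q / (s * t * l) / x^2 * (x - 1) * (x / (l * q) - l * q)
                 * (1 - s * t * l * c * x / q) * (1 - s * t * l * x / (c * q))"
    and "Q \<equiv> q^2 + 1 / q^2"
    and "g \<equiv> (t * l + 1 / (t * l)) * (s * l + 1 / (s * l)) + (c + 1 / c) * (l * q + 1 / (l * q))"
    and "h \<equiv> (c + 1 / c) * (t * l + 1 / (t * l)) + (s * l + 1 / (s * l)) * (l * q + 1 / (l * q))"
  shows "(2 - Q) * (T x)^2 * S x + (q^2 - 1 / q^2)^2 * S x
          + (T x + T (x / q^2) - Q * T x) * F x + (T x + T (x * q^2) - Q * T x) * F (x * q^2)
          + (q - 1 / q)^2 * g * T x - (q - 1 / q) * (q^2 - 1 / q^2) * h = 0"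
  using assms(1-6) unfolding T_def S_def F_def Q_def g_def h_def
  apply (simp add: divide_simps)
  apply algebra
  done

text \<open>Kills the coefficients two places off the diagonal: \<open>v (k - 2)\<close> in one
  relation, \<open>v (k + 2)\<close> in the other.\<close>

lemma three_term_identity:
  fixes q t x :: "'a::field"
  assumes "q \<noteq> 0" "t \<noteq> 0" "x \<noteq> 0"
  defines "T \<equiv> \<lambda>x. t * x + 1 / (t * x)"
  shows "T (x / q^2) + T (x * q^2) = (q^2 + 1 / q^2) * T x"
  using assms(1-3) unfolding T_def
  apply (simp add: divide_simps)
  apply algebra
  done

text \<open>Kills the remaining coefficient: \<open>v (k + 1)\<close> in the relation quadratic in
  A, \<open>v (k - 1)\<close> in the one quadratic in B.\<close>

lemma adjacent_quadratic_identity: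
  fixes q t x :: "'a::field"
  assumes "q \<noteq> 0" "t \<noteq> 0" "x \<noteq> 0"
  defines "T \<equiv> \<lambda>x. t * x + 1 / (t * x)"
  shows "(T x)^2 + (T (x * q^2))^2 - (q^2 + 1 / q^2) * T x * T (x * q^2) + (q^2 - 1 / q^2)^2 = 0"
  using assms(1-3) unfolding T_def
  apply (simp add: divide_simps)
  apply algebra
  done

text \<open>
  The letters x, y, z, w stand for the indices k, k - 1, k - 2, k + 1 in the first lemma and for
  k, k - 1, k + 2, k + 1 in the second one; d, d', d'' are the wrap-around factors of A.
\<close>

lemma combine_AAB:
  fixes Q :: "'b::comm_ring_1"
  assumes "Sz + Sx = Q * Sy"
    and "Fy - Q * Fx + Fw + (Tx + Ty) * (Sx + Sy) - Q * (Tx * Sx + Ty * Sy) + g = 0"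
    and "(2 - Q) * Tx^2 * Sx + r * Sx + (Tx + Ty - Q * Tx) * Fx + (Tx + Tw - Q * Tx) * Fw + g * Tx - h = 0"
    and "Tx^2 + Tw^2 - Q * Tx * Tw + r = 0"
    and "d * Fx = Fx" "d' * Fy = Fy" "d'' * Fw = Fw"
  shows "Tx * (Tx * (Sx * vx + Fw * vw) + d * (Sy * vy + Fx * vx))
       + d * (Ty * (Sy * vy + Fx * vx) + d' * (Sz * vz + Fy * vy))
       - Q * (Tx * (Sx * (Tx * vx + d * vy) + Fw * (Tw * vw + d'' * vx))
              + d * (Sy * (Ty * vy + d' * vz) + Fx * (Tx * vx + d * vy)))
       + (Sx * (Tx * (Tx * vx + d * vy) + d * (Ty * vy + d' * vz))
          + Fw * (Tw * (Tw * vw + d'' * vx) + d'' * (Tx * vx + d * vy)))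
       + r * (Sx * vx + Fw * vw) = h * vx - g * (Tx * vx + d * vy)"
proof -
  have "Fw * (Tw * (Tw * vw + d'' * vx) + d'' * (Tx * vx + d * vy))
      = Fw * Tw * Tw * vw + (d'' * Fw) * Tw * vx + (d'' * Fw) * (Tx * vx + d * vy)"
    by (simp add: algebra_simps)
  also have "\<dots> = Fw * Tw * Tw * vw + Fw * Tw * vx + Fw * (Tx * vx + d * vy)"
    by (simp only: assms)
  finally have 1: "Fw * (Tw * (Tw * vw + d'' * vx) + d'' * (Tx * vx + d * vy))
      = Fw * Tw * Tw * vw + Fw * Tw * vx + Fw * (Tx * vx + d * vy)" .
  have "Fw * (Tw * vw + d'' * vx) = Fw * Tw * vw + (d'' * Fw) * vx" by (simp add: algebra_simps)
  then have 2: "Fw * (Tw * vw + d'' * vx) = Fw * Tw * vw + Fw * vx" by (simp only: assms)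
  have "d' * (Sz * vz + Fy * vy) = d' * Sz * vz + (d' * Fy) * vy" by (simp add: algebra_simps)
  then have 3: "d' * (Sz * vz + Fy * vy) = d' * Sz * vz + Fy * vy" by (simp only: assms)
  have "d * (Sy * vy + Fx * vx) = d * Sy * vy + (d * Fx) * vx" by (simp add: algebra_simps)
  then have 4: "d * (Sy * vy + Fx * vx) = d * Sy * vy + Fx * vx" by (simp only: assms)
  have 5: "d * (Ty * (Sy * vy + Fx * vx) + (d' * Sz * vz + Fy * vy)) 
     = d * Ty * Sy * vy + (d * Fx) * Ty * vx + d * d' * Sz * vz + d * Fy * vy"
    by (simp add: algebra_simps)
  have 6: "d * (Sy * (Ty * vy + d' * vz) + Fx * (Tx * vx + d * vy))
     = d * Sy * Ty * vy + d * d' * Sy * vz + (d * Fx) * Tx * vx + (d * vy) * (d * Fx)"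
    by (simp add: algebra_simps)
  \<comment> \<open>Each scalar hypothesis becomes a vanishing expression; the claim is their
    combination with the coordinates of \<open>v\<close>, up to wrap-around factors and phi, as
    coefficients.\<close>
  define E1 where "E1 = Sz + Sx - Q * Sy"
  define E2 where "E2 = Fy - Q * Fx + Fw + (Tx + Ty) * (Sx + Sy) - Q * (Tx * Sx + Ty * Sy) + g"
  define E3 where "E3 = (2 - Q) * Tx^2 * Sx + r * Sx + (Tx + Ty - Q * Tx) * Fx + (Tx + Tw - Q * Tx) * Fw + g * Tx - h"
  define E4 where "E4 = Tx^2 + Tw^2 - Q * Tx * Tw + r"
  have "E1 = 0" "E2 = 0" "E3 = 0" "E4 = 0"
    using assms by (simp_all add: E1_def E2_def E3_def E4_def)
  then have "E1 * d * d' * vz + E2 * d * vy + E3 * vx + E4 * Fw * vw = 0" by simp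
  then show ?thesis unfolding 1 2 3 4 5 6 assms(5) E1_def E2_def E3_def E4_def
    by (simp add: algebra_simps power2_eq_square)
qed

lemma combine_BBA:
  fixes Q :: "'b::comm_ring_1"
  assumes "Tx + Tz = Q * Tw"
    and "Fx - Q * Fw + Fz + (Tw + Tx) * (Sw + Sx) - Q * (Tw * Sw + Tx * Sx) + g = 0"
    and "(2 - Q) * Sx^2 * Tx + r * Tx + (Sx + Sy - Q * Sx) * Fx + (Sx + Sw - Q * Sx) * Fw + g * Sx - h = 0"
    and "Sy^2 + Sx^2 - Q * Sy * Sx + r = 0"
    and "d * Fx = Fx" "d' * Fw = Fw" "d'' * Fz = Fz"
  shows "Sx * (Sx * (Tx * vx + d * vy) + Fw * (Tw * vw + d' * vx))
       + Fw * (Sw * (Tw * vw + d' * vx) + Fz * (Tz * vz + d'' * vw))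
       - Q * (Sx * (Tx * (Sx * vx + Fw * vw) + d * (Sy * vy + Fx * vx))
              + Fw * (Tw * (Sw * vw + Fz * vz) + d' * (Sx * vx + Fw * vw)))
       + (Tx * (Sx * (Sx * vx + Fw * vw) + Fw * (Sw * vw + Fz * vz))
          + d * (Sy * (Sy * vy + Fx * vx) + Fx * (Sx * vx + Fw * vw)))
       + r * (Tx * vx + d * vy) = h * vx - g * (Sx * vx + Fw * vw)"
proof -
  have "Fw * (Tw * vw + d' * vx) = Fw * Tw * vw + (d' * Fw) * vx" by (simp add: algebra_simps)
  then have 1: "Fw * (Tw * vw + d' * vx) = Fw * Tw * vw + Fw * vx" by (simp only: assms)
  have "Fz * (Tz * vz + d'' * vw) = Fz * Tz * vz + (d'' * Fz) * vw" by (simp add: algebra_simps)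
  then have 2: "Fz * (Tz * vz + d'' * vw) = Fz * Tz * vz + Fz * vw" by (simp only: assms)
  have "d * (Sy * vy + Fx * vx) = d * Sy * vy + (d * Fx) * vx" by (simp add: algebra_simps)
  then have 3: "d * (Sy * vy + Fx * vx) = d * Sy * vy + Fx * vx" by (simp only: assms)
  have 4: "Fw * (Sw * (Tw * vw + d' * vx) + (Fz * Tz * vz + Fz * vw))
    = Fw * Sw * Tw * vw + Sw * (d' * Fw) * vx + Fw * Fz * Tz * vz + Fw * Fz * vw"
    by (simp add: algebra_simps)
  have 5: "Fw * (Tw * (Sw * vw + Fz * vz) + d' * (Sx * vx + Fw * vw))
    = Fw * Tw * Sw * vw + Fw * Tw * Fz * vz + (d' * Fw) * Sx * vx + (d' * Fw) * Fw * vw"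
    by (simp add: algebra_simps)
  have 6: "d * (Sy * (Sy * vy + Fx * vx) + Fx * (Sx * vx + Fw * vw))
    = d * Sy * Sy * vy + Sy * (d * Fx) * vx + (d * Fx) * Sx * vx + (d * Fx) * Fw * vw"
    by (simp add: algebra_simps)
  define E1 where "E1 = Tx + Tz - Q * Tw"
  define E2 where "E2 = Fx - Q * Fw + Fz + (Tw + Tx) * (Sw + Sx) - Q * (Tw * Sw + Tx * Sx) + g"
  define E3 where "E3 = (2 - Q) * Sx^2 * Tx + r * Tx + (Sx + Sy - Q * Sx) * Fx + (Sx + Sw - Q * Sx) * Fw + g * Sx - h"
  define E4 where "E4 = Sy^2 + Sx^2 - Q * Sy * Sx + r"
  have "E1 = 0" "E2 = 0" "E3 = 0" "E4 = 0"
    using assms by (simp_all add: E1_def E2_def E3_def E4_def)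
  then have "E1 * Fw * Fz * vz + E2 * Fw * vw + E3 * vx + E4 * d * vy = 0" by simp
  then show ?thesis unfolding 1 2 3 4 5 6 assms(5,6) E1_def E2_def E3_def E4_def
    by (simp add: algebra_simps power2_eq_square)
qed

section \<open>The module W, with \<open>n\<close> for d' and \<open>q^2\<close> of exact order
  \<open>n\<close>\<close>

locale W_module =
  fixes q a b c l \<delta> :: "'a::field" and n :: nat
  assumes n_ge: "n \<ge> 3"
    and q_pow_n: "(q^2)^n = 1"
    and q_pow_less: "\<And>k. 0 < k \<Longrightarrow> k < n \<Longrightarrow> (q^2)^k \<noteq> 1"
    and nonzero: "a \<noteq> 0" "b \<noteq> 0" "c \<noteq> 0" "l \<noteq> 0"
begin

abbreviation A where "A \<equiv> actA q a l \<delta> n"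
abbreviation B where "B \<equiv> actB q a b c l n"

definition Q where "Q = q^2 + 1/q^2"
definition \<rho> where "\<rho> = (q^2 - 1/q^2)^2"
text \<open>The eigenvalues of the central elements gamma, alpha and beta on W, rescaled by the
  factors that appear when C is eliminated from the defining relations.\<close>

definition gam where "gam = (q - 1/q)^2 * ((a+1/a)*(b+1/b) + (c+1/c)*(l*q+1/(l*q)))"
definition alf where "alf = (q-1/q)*(q^2-1/q^2) * ((c+1/c)*(b+1/b) + (a+1/a)*(l*q+1/(l*q)))"
definition bet where "bet = (q-1/q)*(q^2-1/q^2) * ((c+1/c)*(a+1/a) + (b+1/b)*(l*q+1/(l*q)))"

text \<open>theta_k, theta*_k and phi_k as rational functions of \<open>x = q^(2k)\<close> (the odd
  powers of \<open>q^k\<close> in phi cancel), so that an index shift becomes multiplication by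
  \<open>q^2\<close>.\<close>

definition T where "T x = (a/l)*x + 1/((a/l)*x)"
definition S where "S x = (b/l)*x + 1/((b/l)*x)"
definition F where "F x = q / ((b/l) * (a/l) * l) / x^2 * (x - 1) * (x / (l * q) - l * q)
                 * (1 - (b/l) * (a/l) * l * c * x / q) * (1 - (b/l) * (a/l) * l * x / (c * q))"

text \<open>
  Indices are read cyclically modulo n. The factor \<delta> that A picks up when wrapping around does not
  disturb the relations, since phi vanishes at the same place.
\<close>

definition X where "X k = (q^2)^k"
definition pr where "pr k = (if k = 0 then n - 1 else k - 1)"
definition sc where "sc k = (if Suc k = n then 0 else Suc k)"
definition dl where "dl k = (if k = 0 then \<delta> else 1)"

lemma q_nonzero: "q \<noteq> 0"
  using q_pow_n n_ge by (auto simp: zero_power)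

lemma q4: "q^4 \<noteq> 1"
  using q_pow_less[of 2] n_ge by (simp flip: power_mult)

lemma X_nonzero: "X k \<noteq> 0" by (simp add: X_def q_nonzero)

lemma X_pr: "k < n \<Longrightarrow> X (pr k) = X k / q^2"
proof (cases k)
  case 0
  assume "k < n"
  have "X (n - 1) * q^2 = (q^2)^Suc (n-1)" by (simp add: X_def)
  also have "\<dots> = 1" using n_ge q_pow_n by simp
  finally show ?thesis using 0 q_nonzero by (simp add: pr_def X_def divide_simps)
next
  case (Suc m)
  then show ?thesis using q_nonzero by (simp add: pr_def X_def)
qed

lemma X_sc: "k < n \<Longrightarrow> X (sc k) = X k * q^2"
  using q_pow_n by (auto simp: sc_def X_def power_Suc2 simp del: power_Suc)

lemma powi_X: "q powi (2 * int k) = X k" "q powi (- (2 * int k)) = 1 / X k"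
proof -
  show *: "q powi (2 * int k) = X k"
    by (simp add: X_def power_int_mult)
  show "q powi (- (2 * int k)) = 1 / X k"
    by (subst power_int_minus) (simp only: * inverse_eq_divide)
qed

lemma theta_X: "theta q a l k = T (X k)"
  using powi_X[of k] nonzero X_nonzero[of k] by (simp add: theta_def T_def field_simps)

lemma theta_s_X: "theta_s q b l k = S (X k)"
  using powi_X[of k] nonzero X_nonzero[of k] by (simp add: theta_s_def S_def field_simps)

lemma phi_X: "phi q a b c l k = F (X k)"
proof -
  define z where "z = q ^ k"
  have z: "z \<noteq> 0" "X k = z^2" using q_nonzero by (auto simp: z_def X_def power2_eq_square power_mult_distrib simp flip: power_mult)
  have p: "q powi int k = z" "q powi (- int k) = 1/z" "q powi (int k - 1) = z/q" "q powi (1 - int k) = q/z"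
    using q_nonzero by (simp_all add: z_def power_int_diff power_int_minus inverse_eq_divide)
  show ?thesis unfolding phi_def F_def p z(2)
    using z(1) q_nonzero nonzero
    apply (simp add: divide_simps)
    apply algebra
    done
qed

lemma F_1: "F 1 = 0" by (simp add: F_def)

lemma X_0: "X 0 = 1" by (simp add: X_def)

lemma dl_F: "dl k * F (X k) = F (X k)"
  by (simp add: dl_def X_0 F_1)

lemma A_apply: "k < n \<Longrightarrow> A v k = T (X k) * v k + dl k * v (pr k)"
  by (simp add: actA_def theta_X dl_def pr_def)

lemma B_apply: "k < n \<Longrightarrow> B v k = S (X k) * v k + F (X (sc k)) * v (sc k)"
  by (simp add: actB_def theta_s_X phi_X sc_def X_0 F_1)

lemma A_outside: "k \<ge> n \<Longrightarrow> A v k = 0" by (simp add: actA_def)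
lemma B_outside: "k \<ge> n \<Longrightarrow> B v k = 0" by (simp add: actB_def)

lemma pr_less: "k < n \<Longrightarrow> pr k < n" by (auto simp: pr_def)
lemma sc_less: "k < n \<Longrightarrow> sc k < n" by (auto simp: sc_def)
lemma pr_sc: "k < n \<Longrightarrow> pr (sc k) = k" by (auto simp: pr_def sc_def)
lemma sc_pr: "k < n \<Longrightarrow> sc (pr k) = k" by (auto simp: pr_def sc_def)

text \<open>In the algebra this is the defining relation for beta after C is eliminated by means of
  gamma; here it is verified coordinate by coordinate from the scalar identities.\<close>

lemma relation_AAB:
  assumes "k < n"
  shows "A (A (B v)) k - Q * A (B (A v)) k + B (A (A v)) k + \<rho> * B v k = bet * v k - gam * A v k"
proof -
  define x where "x = X k"
  have x: "x \<noteq> 0" "x / q^2 \<noteq> 0" "X (pr k) = x / q^2" "X (pr (pr k)) = x / q^2 / q^2" "X (sc k) = x * q^2"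
    using assms q_nonzero by (auto simp: x_def X_nonzero X_pr X_sc pr_less)
  have al: "a / l \<noteq> 0" "b / l \<noteq> 0" using nonzero by auto
  have abl: "a / l * l = a" "b / l * l = b" using nonzero by auto
  note * = q_nonzero al nonzero(4,3)
  have e2: "F (x / q^2) - Q * F x + F (x * q^2) + (T x + T (x / q^2)) * (S x + S (x / q^2))
          - Q * (T x * S x + T (x / q^2) * S (x / q^2)) + gam = 0"
    using lower_coefficient_identity[OF * x(1)]
    unfolding F_def Q_def T_def S_def gam_def abl by simp
  have e3: "(2 - Q) * (T x)^2 * S x + \<rho> * S x
          + (T x + T (x / q^2) - Q * T x) * F x + (T x + T (x * q^2) - Q * T x) * F (x * q^2)
          + gam * T x - bet = 0"
    using diagonal_coefficient_identity[OF * x(1)]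
    unfolding F_def Q_def T_def S_def gam_def bet_def \<rho>_def abl by simp
  have e1: "S (x / q^2 / q^2) + S x = Q * S (x / q^2)"
    using three_term_identity[OF q_nonzero al(2) x(2)] q_nonzero unfolding S_def Q_def by simp
  have e4: "(T x)^2 + (T (x * q^2))^2 - Q * T x * T (x * q^2) + \<rho> = 0"
    using adjacent_quadratic_identity[OF q_nonzero al(1) x(1)] unfolding T_def Q_def \<rho>_def by simp
  have dF: "dl k * F x = F x" "dl (pr k) * F (x / q^2) = F (x / q^2)" "dl (sc k) * F (x * q^2) = F (x * q^2)"
    using dl_F[of k] dl_F[of "pr k"] dl_F[of "sc k"] x by (auto simp: x_def)
  show ?thesis
    using combine_AAB[OF e1 e2 e3 e4 dF, of "v k" "v (sc k)" "v (pr k)" "v (pr (pr k))"]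
    by (simp only: assms A_apply B_apply pr_less sc_less pr_sc sc_pr x(3-5) flip: x_def)
qed

lemma relation_BBA:
  assumes "k < n"
  shows "B (B (A v)) k - Q * B (A (B v)) k + A (B (B v)) k + \<rho> * A v k = alf * v k - gam * B v k"
proof -
  define x where "x = X k"
  have x: "x \<noteq> 0" "x * q^2 \<noteq> 0" "x / q^2 \<noteq> 0" "X (pr k) = x / q^2" "X (sc (sc k)) = x * q^2 * q^2" "X (sc k) = x * q^2"
    using assms q_nonzero by (auto simp: x_def X_nonzero X_pr X_sc sc_less)
  have al: "a / l \<noteq> 0" "b / l \<noteq> 0" using nonzero by auto
  have abl: "a / l * l = a" "b / l * l = b" using nonzero by auto
  note * = q_nonzero al nonzero(4,3)
  have sym: "b / l * (a / l) = a / l * (b / l)" by simp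
  have e2: "F x - Q * F (x * q^2) + F (x * q^2 * q^2) + (T (x * q^2) + T x) * (S (x * q^2) + S x)
          - Q * (T (x * q^2) * S (x * q^2) + T x * S x) + gam = 0"
    using lower_coefficient_identity[OF * x(2)] q_nonzero
    unfolding F_def Q_def T_def S_def gam_def abl by simp
  \<comment> \<open>The diagonal identity with \<open>t\<close> and \<open>s\<close> exchanged;
    \<open>sym\<close> restores the order of the factors in \<open>F\<close>.\<close>
  have e3: "(2 - Q) * (S x)^2 * T x + \<rho> * T x
          + (S x + S (x / q^2) - Q * S x) * F x + (S x + S (x * q^2) - Q * S x) * F (x * q^2)
          + gam * S x - alf = 0"
    using diagonal_coefficient_identity[OF q_nonzero al(2,1) nonzero(4,3) x(1)]
    unfolding F_def Q_def T_def S_def gam_def alf_def \<rho>_def abl sym by (simp add: mult.commute)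
  have e1: "T x + T (x * q^2 * q^2) = Q * T (x * q^2)"
    using three_term_identity[OF q_nonzero al(1) x(2)] q_nonzero unfolding T_def Q_def by simp
  have e4: "(S (x / q^2))^2 + (S x)^2 - Q * S (x / q^2) * S x + \<rho> = 0"
    using adjacent_quadratic_identity[OF q_nonzero al(2) x(3)] q_nonzero unfolding S_def Q_def \<rho>_def by simp
  have dF: "dl k * F x = F x" "dl (sc k) * F (x * q^2) = F (x * q^2)"
     "dl (sc (sc k)) * F (x * q^2 * q^2) = F (x * q^2 * q^2)"
    using dl_F[of k] dl_F[of "sc (sc k)"] dl_F[of "sc k"] x by (auto simp: x_def)
  show ?thesis
    using combine_BBA[OF e1 e2 e3 e4 dF, of "v k" "v (pr k)" "v (sc k)" "v (sc (sc k))"]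
    by (simp only: assms A_apply B_apply pr_less sc_less pr_sc sc_pr x(4-6) flip: x_def)
qed

end

section \<open>Marginal vectors generate proper submodules\<close>

definition vscale :: "'a::field \<Rightarrow> (nat \<Rightarrow> 'a) \<Rightarrow> nat \<Rightarrow> 'a" where
  "vscale c v = (\<lambda>k. c * v k)"

lemma vscale_apply: "vscale c v k = c * v k" by (simp add: vscale_def)

interpretation coords: vector_space vscale
  by unfold_locales (simp_all add: fun_eq_iff vscale_def algebra_simps)

lemmas vec_apply = vscale_apply plus_fun_apply zero_fun_apply minus_apply

text \<open>As simp rules, these would also rewrite unapplied sums, turning equations between vectors into pointwise ones.\<close>

declare plus_fun_apply [simp del] zero_fun_apply [simp del] minus_apply [simp del]

definition unit_vec :: "nat \<Rightarrow> nat \<Rightarrow> 'a::field" where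
  "unit_vec i = (\<lambda>k. if k = i then 1 else 0)"

text \<open>The \<open>n\<close> unit vectors are independent, so fewer than \<open>n\<close>
  vectors cannot span; this shows that the submodule built below is proper.\<close>

lemma Wvecs_not_spanned:
  assumes "finite E" "card E < n"
  shows "\<not> (Wvecs n :: (nat \<Rightarrow> 'a::field) set) \<subseteq> coords.span E"
proof
  assume sub: "(Wvecs n :: (nat \<Rightarrow> 'a) set) \<subseteq> coords.span E"
  let ?V = "(unit_vec :: nat \<Rightarrow> nat \<Rightarrow> 'a) ` {..<n}"
  have inj: "inj_on (unit_vec :: nat \<Rightarrow> nat \<Rightarrow> 'a) {..<n}"
    by (rule inj_onI) (metis unit_vec_def zero_neq_one)
  have "coords.independent ?V"
  proof (rule coords.independent_if_scalars_zero)
    fix g and w :: "nat \<Rightarrow> 'a"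
    assume z: "(\<Sum>v\<in>?V. vscale (g v) v) = 0" and w: "w \<in> ?V"
    then obtain i where i: "i < n" "w = unit_vec i" by auto
    have "(\<Sum>v\<in>?V. vscale (g v) v) = (\<Sum>j<n. vscale (g (unit_vec j)) (unit_vec j))"
      by (simp add: sum.reindex[OF inj])
    then have "(\<Sum>j<n. vscale (g (unit_vec j)) (unit_vec j)) i = 0" using z by (simp add: vec_apply)
    moreover have "(\<Sum>j<n. vscale (g (unit_vec j)) (unit_vec j)) i
        = (\<Sum>j<n. g (unit_vec j) * (if i = j then 1 else 0))" for g :: "(nat \<Rightarrow> 'a) \<Rightarrow> 'a"
      by (induction n) (simp_all add: unit_vec_def vec_apply)
    ultimately show "g w = 0" using i by (simp add: sum.delta' if_distrib cong: if_cong)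
  qed simp
  moreover have "?V \<subseteq> coords.span E" using sub by (auto simp: Wvecs_def unit_vec_def subset_iff)
  ultimately have "card ?V \<le> card E" using coords.independent_span_bound[OF assms(1)] by blast
  then show False using assms(2) card_image[OF inj] by simp
qed

lemma (in W_module) A_add: "A (u + v) = A u + A v"
  by (auto simp: fun_eq_iff vec_apply actA_def algebra_simps)

lemma (in W_module) B_add: "B (u + v) = B u + B v"
  by (auto simp: fun_eq_iff vec_apply actB_def algebra_simps)

lemma (in W_module) A_scale: "A (vscale r v) = vscale r (A v)"
  by (auto simp: fun_eq_iff vec_apply actA_def algebra_simps)

lemma (in W_module) B_scale: "B (vscale r v) = vscale r (B v)"
  by (auto simp: fun_eq_iff vec_apply actB_def algebra_simps)

lemma (in W_module) A_Wvecs: "A v \<in> Wvecs n" by (simp add: Wvecs_def A_outside)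
lemma (in W_module) B_Wvecs: "B v \<in> Wvecs n" by (simp add: Wvecs_def B_outside)

lemma (in W_module) A_zero: "A 0 = 0" by (auto simp: fun_eq_iff vec_apply actA_def)
lemma (in W_module) B_zero: "B 0 = 0" by (auto simp: fun_eq_iff vec_apply actB_def)

lemma (in W_module) Wvecs_subspace: "coords.subspace (Wvecs n)"
  by (simp add: coords.subspace_def Wvecs_def vec_apply)

text \<open>C acts as a linear combination of the identity, AB and BA, so its invariance follows
  from that of A and B.\<close>

lemma (in W_module) W_submoduleI:
  assumes "coords.subspace U" "U \<subseteq> Wvecs n"
    and A: "\<And>u. u \<in> U \<Longrightarrow> A u \<in> U" and B: "\<And>u. u \<in> U \<Longrightarrow> B u \<in> U"
  shows "W_submodule q a b c l \<delta> n U"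
proof -
  have "actC q a b c l \<delta> n u \<in> U" if u: "u \<in> U" for u
  proof -
    have "actC q a b c l \<delta> n u = vscale (gamma_val q a b c l / (q + inverse q)) u
        - vscale (inverse (q^2 - inverse q^2)) (vscale q (A (B u)) - vscale (inverse q) (B (A u)))"
      by (simp add: fun_eq_iff vec_apply actC_def divide_inverse mult.commute)
    then show ?thesis using u assms
      by (auto intro!: coords.subspace_diff coords.subspace_scale)
  qed
  then show ?thesis
    using assms coords.subspace_0[OF assms(1)] coords.subspace_add[OF assms(1)] coords.subspace_scale[OF assms(1)]
    unfolding W_submodule_def by (auto simp: plus_fun_def zero_fun_def vscale_def)
qed

lemma (in W_module) W_submoduleD:
  assumes "W_submodule q a b c l \<delta> n U"
  shows "coords.subspace U" "U \<subseteq> Wvecs n" "u \<in> U \<Longrightarrow> A u \<in> U" "u \<in> U \<Longrightarrow> B u \<in> U"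
  using assms unfolding W_submodule_def coords.subspace_def
  by (auto simp: plus_fun_def zero_fun_def vscale_def)

lemma (in W_module) relation_AAB_vec:
  assumes "v \<in> Wvecs n"
  shows "A (A (B v)) - vscale Q (A (B (A v))) + B (A (A v)) + vscale \<rho> (B v)
       = vscale bet v - vscale gam (A v)"
proof
  fix k
  show "(A (A (B v)) - vscale Q (A (B (A v))) + B (A (A v)) + vscale \<rho> (B v)) k
       = (vscale bet v - vscale gam (A v)) k"
    using relation_AAB[of k v] assms
    by (cases "k < n") (simp_all add: A_outside B_outside Wvecs_def vec_apply)
qed

lemma (in W_module) relation_BBA_vec:
  assumes "v \<in> Wvecs n"
  shows "B (B (A v)) - vscale Q (B (A (B v))) + A (B (B v)) + vscale \<rho> (A v)
       = vscale alf v - vscale gam (B v)"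
proof
  fix k
  show "(B (B (A v)) - vscale Q (B (A (B v))) + A (B (B v)) + vscale \<rho> (A v)) k
       = (vscale alf v - vscale gam (B v)) k"
    using relation_BBA[of k v] assms
    by (cases "k < n") (simp_all add: A_outside B_outside Wvecs_def vec_apply)
qed

section \<open>The chain of vectors obtained from shifted copies of B\<close>

abbreviation (in W_module) Bp where "Bp \<equiv> Bprod q a b c l n"

lemma (in W_module) B_Bp: "B (Bp m v) = Bp (Suc m) v + vscale (theta_s q b l (n - Suc m)) (Bp m v)"
  by (simp add: fun_eq_iff vec_apply)

text \<open>B is triangular with theta*_k on the diagonal, so each factor
  \<open>B - theta*_{n-m}\<close> clears the highest coordinate still present.\<close>

lemma (in W_module) Bp_support:
  assumes "v \<in> Wvecs n" "k + m \<ge> n" "m < n"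
  shows "Bp m v k = 0"
  using assms(2,3)
proof (induction m arbitrary: k)
  case 0
  then show ?case using assms(1) by (simp add: Wvecs_def)
next
  case (Suc m)
  have next0: "Bp m v (Suc k) = 0" using Suc by simp
  show ?case
  proof (cases "k = n - Suc m")
    case True
    then show ?thesis using next0 Suc.prems by (simp add: actB_def)
  next
    case False
    then have "Bp m v k = 0" using Suc by simp
    then show ?thesis using next0 by (simp add: actB_def)
  qed
qed

lemma (in W_module) Bp_Wvecs: "v \<in> Wvecs n \<Longrightarrow> Bp m v \<in> Wvecs n"
  by (induction m) (auto simp: Wvecs_def B_outside)

lemma (in W_module) Bp_full:
  assumes "v \<in> Wvecs n"
  shows "Bp (n - 1) v = vscale (Bp (n - 1) v 0) (unit_vec 0)"
proof
  fix k
  show "Bp (n - 1) v k = vscale (Bp (n - 1) v 0) (unit_vec 0) k"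
    using Bp_support[OF assms, of k "n - 1"] n_ge by (cases k) (auto simp: unit_vec_def vec_apply)
qed

lemma (in W_module) marginal_vector_imp_reducible:
  assumes e: "e \<in> Wvecs n" "e \<noteq> 0" "A e = vscale \<theta> e"
    and marginal: "A (B e) - vscale \<eta> (B e) = vscale \<xi> e"
    and L: "Bp (n - 1) e 0 = 0"
  shows "W_reducible q a b c l \<delta> n"
proof -
  define t where "t k = Bp k e" for k
  define U where "U = coords.span (t ` {..<n-1})"
  have U: "coords.subspace U" by (simp add: U_def)
  note clos = coords.subspace_add[OF U] coords.subspace_diff[OF U] coords.subspace_scale[OF U]
  have tW: "t k \<in> Wvecs n" for k using Bp_Wvecs e by (simp add: t_def)
  \<comment> \<open>Here L = 0 enters: the last vector of the chain has only a coordinate at w_0,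
    namely L.\<close>
  have tn: "t (n - 1) = 0" using Bp_full[OF e(1), unfolded L] by (simp add: t_def)
  have tU: "t k \<in> U" if "k \<le> n - 1" for k
    using that tn U by (cases "k = n - 1") (auto simp: U_def coords.span_zero intro!: coords.span_base)
  have Bt: "B (t k) = t (Suc k) + vscale (theta_s q b l (n - Suc k)) (t k)" for k
    unfolding t_def by (rule B_Bp)
  have BU: "B u \<in> U" if "u \<in> U" for u
    using that unfolding U_def
  proof (induction rule: coords.span_induct_alt)
    case base
    show ?case unfolding B_zero by (rule coords.span_zero)
  next
    case (step r x y)
    then obtain k where k: "k < n - 1" "x = t k" by blast
    then have "B x \<in> U" unfolding k(2) Bt using tU clos by simp
    then show ?case unfolding B_add B_scale using step(2) clos by (simp only: U_def)
  qed
  have UW: "U \<subseteq> Wvecs n"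
    unfolding U_def by (rule coords.span_minimal) (use tW Wvecs_subspace in auto)
  have At: "A (t k) \<in> U" if "k < n - 1" for k
    using that
  proof (induction k rule: less_induct)
    case (less k)
    have t0: "t 0 = e" by (simp add: t_def)
    have eU: "e \<in> U" using tU[of 0] t0 by simp
    consider "k = 0" | "k = 1" | j where "k = Suc (Suc j)" by (metis One_nat_def not0_implies_Suc)
    then show ?case
    proof cases
      case 1
      then show ?thesis using e(3) t0 eU clos by simp
    next
      case 2
      have t1: "t 1 = B e - vscale (theta_s q b l (n - 1)) e" using Bt[of 0] t0 by simp
      have Be: "B e \<in> U" using BU eU by blast
      \<comment> \<open>Marginality gives the second base case; the induction step reaches back two
        indices.\<close>
      have "A (B e) = vscale \<eta> (B e) + vscale \<xi> e" using marginal by (simp add: algebra_simps)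
      then have "A (B e) \<in> U" using Be eU clos by simp
      moreover have "A (t 1) = A (B e) + vscale (- theta_s q b l (n - 1)) (A e)"
        unfolding t1 by (simp flip: A_scale A_add)
      ultimately show ?thesis using 2 e(3) eU clos by simp
    next
      case 3
      define r where "r = theta_s q b l (n - Suc j)"
      define s where "s = theta_s q b l (n - Suc (Suc j))"
      have Bj: "B (t j) = t (Suc j) + vscale r (t j)" unfolding r_def by (rule Bt)
      have Aj: "A (t j) \<in> U" "A (t (Suc j)) \<in> U" using less 3 by auto
      have tj: "t j \<in> U" "t (Suc j) \<in> U" using tU less.prems 3 by auto
      have ABj: "A (B (t j)) \<in> U" using Aj clos by (simp add: Bj A_add A_scale)
      \<comment> \<open>In every term on the right, A acts first on \<open>t j\<close> or
        \<open>B (t j)\<close>, where the induction hypothesis applies, or is absent.\<close>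
      have "A (B (B (t j))) = vscale alf (t j) - vscale gam (B (t j)) - B (B (A (t j)))
          + vscale Q (B (A (B (t j)))) - vscale \<rho> (A (t j))"
        using relation_BBA_vec[OF tW, of j] by (simp add: algebra_simps)
      moreover have "\<dots> \<in> U"
        by (intro coords.subspace_add[OF U] coords.subspace_diff[OF U] coords.subspace_scale[OF U] BU Aj tj ABj)
      ultimately have ABB: "A (B (B (t j))) \<in> U" by simp
      have "t k = B (B (t j)) + vscale (- r) (B (t j)) + vscale (- s) (t (Suc j))"
      proof -
        have "B (B (t j)) = B (t (Suc j)) + vscale r (B (t j))" by (simp only: Bj B_add B_scale)
        moreover have "B (t (Suc j)) = t k + vscale s (t (Suc j))" unfolding 3 s_def by (rule Bt)
        ultimately show ?thesis by (simp add: fun_eq_iff vec_apply)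
      qed
      then have "A (t k) = A (B (B (t j))) + vscale (- r) (A (B (t j))) + vscale (- s) (A (t (Suc j)))"
        by (simp only: A_add A_scale)
      then show ?thesis using ABB ABj Aj clos by simp
    qed
  qed
  have AU: "A u \<in> U" if "u \<in> U" for u
    using that unfolding U_def
  proof (induction rule: coords.span_induct_alt)
    case base
    show ?case unfolding A_zero by (rule coords.span_zero)
  next
    case (step r x y)
    then have "A x \<in> U" using At by blast
    then show ?case unfolding A_add A_scale using step(2) clos by (simp only: U_def)
  qed
  have "U \<noteq> Wvecs n"
  proof -
    have "card (t ` {..<n-1}) < n"
      using card_image_le[of "{..<n-1}" t] n_ge by simp
    then show ?thesis using Wvecs_not_spanned[of "t ` {..<n-1}" n] unfolding U_def by auto
  qed
  moreover have "U \<noteq> {0}" using tU[of 0] e(2) by (auto simp: t_def)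
  moreover have "W_submodule q a b c l \<delta> n U" by (rule W_submoduleI[OF U UW AU BU])
  ultimately show ?thesis unfolding W_reducible_def by (auto simp: zero_fun_def)
qed

section \<open>The module as a quotient of the polynomial ring\<close>

context W_module
begin

abbreviation \<theta> :: "nat \<Rightarrow> 'a" where "\<theta> \<equiv> theta q a l"

text \<open>Since \<open>(A - theta_k) w_k = w_{k+1}\<close>, the vector w_k is
  \<open>newton k\<close>, evaluated at A, applied to w_0.\<close>

definition newton :: "nat \<Rightarrow> 'a poly" where
  "newton k = (\<Prod>j<k. [:- \<theta> j, 1:])"

text \<open>Encodes the wrap-around w_{d'} = delta w_0; it generates the annihilator of w_0.\<close>

definition chi :: "'a poly" where
  "chi = newton n - [:\<delta>:]"

definition to_poly :: "(nat \<Rightarrow> 'a) \<Rightarrow> 'a poly" where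
  "to_poly v = (\<Sum>k<n. smult (v k) (newton k))"

text \<open>p(A) applied to the first basis vector\<close>

definition ev :: "'a poly \<Rightarrow> nat \<Rightarrow> 'a" where
  "ev p = fold_coeffs (\<lambda>r v. vscale r (unit_vec 0) + A v) p 0"

text \<open>The action of B transported to polynomials; it depends only on \<open>p\<close> modulo
  \<open>chi\<close>.\<close>

definition Dop :: "'a poly \<Rightarrow> 'a poly" where
  "Dop p = to_poly (B (ev p))"

lemma A_diff: "A (u - v) = A u - A v"
  using A_add[of "u - v" v] by (simp add: algebra_simps)

lemma newton_Suc: "newton (Suc k) = pCons 0 (newton k) - smult (\<theta> k) (newton k)"
  by (simp add: newton_def)

lemma newton_0: "newton 0 = 1" by (simp add: newton_def)

lemma to_poly_add: "to_poly (u + v) = to_poly u + to_poly v"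
  by (simp add: to_poly_def vec_apply smult_add_left sum.distrib)

lemma to_poly_scale: "to_poly (vscale r v) = smult r (to_poly v)"
  unfolding to_poly_def by (induction n) (simp_all add: vec_apply smult_add_right)

text \<open>A is multiplication by x up to a multiple of \<open>chi\<close>, since wrapping around
  replaces \<open>newton n\<close> by \<open>[:\<delta>:]\<close>.\<close>

lemma to_poly_A: "to_poly (A v) = pCons 0 (to_poly v) - smult (v (n - 1)) chi"
proof -
  obtain m where m: "n = Suc m" using n_ge by (cases n) auto
  have "to_poly (A v) = (\<Sum>k<n. smult (\<theta> k * v k) (newton k))
      + (\<Sum>k<n. smult (if k = 0 then \<delta> * v (n - 1) else v (k - 1)) (newton k))"
    unfolding to_poly_def sum.distrib[symmetric] smult_add_left[symmetric]
    by (intro sum.cong refl) (simp add: actA_def)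
  also have "(\<Sum>k<n. smult (if k = 0 then \<delta> * v (n - 1) else v (k - 1)) (newton k))
      = smult (\<delta> * v (n - 1)) 1 + (\<Sum>k<m. smult (v k) (newton (Suc k)))"
    unfolding m sum.lessThan_Suc_shift by (simp add: newton_0)
  also have "(\<Sum>k<m. smult (v k) (newton (Suc k))) = (\<Sum>k<n. smult (v k) (newton (Suc k))) - smult (v (n - 1)) (newton n)"
    by (simp add: m)
  also have "(\<Sum>k<n. smult (v k) (newton (Suc k)))
      = pCons 0 (to_poly v) - (\<Sum>k<n. smult (\<theta> k * v k) (newton k))"
    unfolding newton_Suc to_poly_def
    by (induction n) (simp_all add: smult_diff_right algebra_simps)
  finally show ?thesis by (simp add: chi_def smult_diff_right)
qed

lemma to_poly_unit: "k < n \<Longrightarrow> to_poly (unit_vec k) = newton k"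
  unfolding to_poly_def
  by (simp add: unit_vec_def if_distrib[of "\<lambda>r. smult r _"] sum.delta' cong: if_cong)

lemma unit_vec_Wvecs: "k < n \<Longrightarrow> unit_vec k \<in> Wvecs n"
  by (simp add: unit_vec_def Wvecs_def)

lemma ev_0: "ev 0 = 0" by (simp add: ev_def)

lemma ev_pCons: "ev (pCons r p) = vscale r (unit_vec 0) + A (ev p)"
proof (cases "p = 0 \<and> r = 0")
  case True
  then show ?thesis by (simp add: ev_0 A_zero)
next
  case False
  then show ?thesis by (cases "p = 0") (simp_all add: ev_def)
qed

lemma ev_shift: "ev (pCons 0 p) = A (ev p)"
  by (simp add: ev_pCons)

lemma ev_add: "ev (p + r) = ev p + ev r"
proof (induction p r rule: poly_induct2)
  case 0
  show ?case by (simp add: ev_0)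
next
  case (pCons x p y r)
  then show ?case by (simp add: ev_pCons A_add coords.scale_left_distrib)
qed

lemma ev_smult: "ev (smult x p) = vscale x (ev p)"
  by (induction p) (simp_all add: ev_0 ev_pCons A_scale coords.scale_right_distrib)

lemma ev_uminus: "ev (- p) = - ev p"
  using ev_add[of p "- p"] by (simp add: ev_0 add_eq_0_iff)

lemma ev_diff: "ev (p - r) = ev p - ev r"
  using ev_add[of p "- r"] by (simp add: ev_uminus)

lemma ev_Wvecs: "ev p \<in> Wvecs n"
proof (induction p)
  case 0
  show ?case unfolding ev_0 using coords.subspace_0[OF Wvecs_subspace] .
next
  case (pCons r p)
  show ?case unfolding ev_pCons
    using n_ge by (intro coords.subspace_add[OF Wvecs_subspace] coords.subspace_scale[OF Wvecs_subspace]
        unit_vec_Wvecs A_Wvecs) auto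
qed

lemma chi_dvd_to_poly_ev: "chi dvd to_poly (ev p) - p"
proof (induction p)
  case 0
  show ?case by (simp add: ev_0 to_poly_def vec_apply)
next
  case (pCons r p)
  obtain k where k: "to_poly (ev p) - p = chi * k" using pCons.IH by (rule dvdE)
  have "to_poly (ev (pCons r p)) - pCons r p
      = pCons 0 (to_poly (ev p) - p) - smult (ev p (n - 1)) chi"
    using n_ge by (simp add: ev_pCons to_poly_add to_poly_scale to_poly_A to_poly_unit newton_0)
  also have "\<dots> = chi * (pCons 0 k - [:ev p (n - 1):])"
    unfolding k by (simp add: algebra_simps)
  finally show ?case by (rule dvdI)
qed

lemma A_unit:
  assumes "k < n"
  shows "A (unit_vec k) = vscale (\<theta> k) (unit_vec k) + (if Suc k = n then vscale \<delta> (unit_vec 0) else unit_vec (Suc k))"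
  using assms n_ge by (auto simp: fun_eq_iff vec_apply actA_def unit_vec_def)

lemma ev_newton: "k < n \<Longrightarrow> ev (newton k) = unit_vec k"
proof (induction k)
  case 0
  then show ?case using ev_pCons[of 1 0] by (simp add: newton_0 one_pCons ev_0 A_zero)
next
  case (Suc k)
  then show ?case by (simp add: newton_Suc ev_diff ev_shift ev_smult A_unit)
qed

lemma ev_chi: "ev chi = 0"
proof -
  obtain m where m: "Suc m = n" "m < n" using n_ge by (cases n) auto
  have "ev (newton n) = vscale \<delta> (unit_vec 0)"
  proof -
    have "newton n = pCons 0 (newton m) - smult (\<theta> m) (newton m)" using newton_Suc[of m] m by simp
    then have "ev (newton n) = A (unit_vec m) - vscale (\<theta> m) (unit_vec m)"
      by (simp only: ev_diff ev_shift ev_smult ev_newton[OF m(2)])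
    then show ?thesis using A_unit[OF m(2)] m(1) by simp
  qed
  moreover have "ev [:\<delta>:] = vscale \<delta> (unit_vec 0)" by (simp add: ev_pCons ev_0 A_zero)
  ultimately show ?thesis by (simp add: chi_def ev_diff)
qed

text \<open>Identifies the kernel of \<open>ev\<close>; as \<open>ev_to_poly\<close> gives
  surjectivity onto W, this is the isomorphism of W with the polynomials modulo
  \<open>chi\<close>.\<close>

lemma ev_eq_0_iff: "ev p = 0 \<longleftrightarrow> chi dvd p"
proof
  assume "ev p = 0"
  then show "chi dvd p" using chi_dvd_to_poly_ev[of p] by (simp add: to_poly_def vec_apply)
next
  assume "chi dvd p"
  then obtain r where "p = r * chi" by (metis dvd_def mult.commute)
  moreover have "ev (r * chi) = 0"
    by (induction r) (simp_all add: ev_0 ev_add ev_smult ev_chi ev_shift A_zero)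
  ultimately show "ev p = 0" by simp
qed

lemma ev_sum: "ev (sum f I) = (\<Sum>i\<in>I. ev (f i))"
  by (induction I rule: infinite_finite_induct) (simp_all add: ev_0 ev_add)

lemma ev_to_poly:
  assumes "v \<in> Wvecs n"
  shows "ev (to_poly v) = v"
proof
  fix k
  have "ev (to_poly v) k = (\<Sum>i<n. vscale (v i) (unit_vec i)) k"
    by (simp add: to_poly_def ev_sum ev_smult ev_newton)
  also have "\<dots> = (\<Sum>i<n. v i * (if k = i then 1 else 0))"
    by (induction n) (simp_all add: vec_apply unit_vec_def)
  also have "\<dots> = v k"
    using assms by (simp add: Wvecs_def if_distrib sum.delta' cong: if_cong)
  finally show "ev (to_poly v) k = v k" .
qed

lemma ev_Dop: "ev (Dop p) = B (ev p)"
  unfolding Dop_def by (rule ev_to_poly[OF B_Wvecs])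

lemma Dop_add: "Dop (p + r) = Dop p + Dop r"
  by (simp add: Dop_def ev_add B_add to_poly_add)

lemma Dop_smult: "Dop (smult x p) = smult x (Dop p)"
  by (simp add: Dop_def ev_smult B_scale to_poly_scale)

lemma Dop_chi: "Dop (chi * p) = 0"
proof -
  have "ev (chi * p) = 0" by (simp add: ev_eq_0_iff)
  then show ?thesis by (simp add: Dop_def B_zero to_poly_def vec_apply)
qed

lemma relation_AAB_poly:
  "chi dvd [:0,0,1:] * Dop p - smult Q ([:0,1:] * Dop ([:0,1:] * p)) + Dop ([:0,0,1:] * p)
      + smult \<rho> (Dop p) - smult bet p + smult gam ([:0,1:] * p)"
proof -
  have x: "[:0,1:] * r = pCons 0 r" "[:0,0,1:] * r = pCons 0 (pCons 0 r)" for r :: "'a poly" by simp_all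
  show ?thesis
    unfolding ev_eq_0_iff[symmetric] x
    using relation_AAB_vec[OF ev_Wvecs[of p]]
    by (simp add: ev_add ev_diff ev_smult ev_shift ev_Dop A_scale A_add A_diff algebra_simps)
qed

lemma degree_newton: "degree (newton k) = k \<and> lead_coeff (newton k) = 1"
proof (induction k)
  case (Suc k)
  have "newton (Suc k) = newton k * [:- \<theta> k, 1:]" by (simp add: newton_def)
  moreover have "newton k \<noteq> 0" using Suc by auto
  ultimately have "degree (newton (Suc k)) = degree (newton k) + degree [:- \<theta> k, 1:]"
    by (simp only: degree_mult_eq pCons_eq_0_iff one_neq_zero simp_thms not_False_eq_True)
  moreover have "lead_coeff (newton (Suc k)) = lead_coeff (newton k) * lead_coeff [:- \<theta> k, 1:]"
    unfolding \<open>newton (Suc k) = _\<close> by (rule lead_coeff_mult)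
  ultimately show ?case using Suc by auto
qed (simp add: newton_def)

lemma chi_monic: "degree chi = n" "lead_coeff chi = 1" "chi \<noteq> 0"
proof -
  have *: "degree [:- \<delta>:] < degree (newton n)" using n_ge by (simp add: degree_newton)
  show 1: "degree chi = n"
    using degree_add_eq_left[OF *] degree_newton[of n]
    by (simp only: chi_def diff_conv_add_uminus minus_pCons minus_zero)
  have "coeff (newton n) n = 1" using degree_newton[of n] by auto
  then show "lead_coeff chi = 1"
    using n_ge coeff_eq_0[of "[:\<delta>:]" n] unfolding 1 by (simp add: chi_def)
  then show "chi \<noteq> 0" by auto
qed

text \<open>Invariance under A makes the polynomials with \<open>ev p \<in> U\<close> an ideal. A
  nonzero member of least degree generates it, and divides \<open>chi\<close> because
  \<open>ev chi = 0\<close>.\<close>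

lemma submodule_ideal:
  assumes U: "W_submodule q a b c l \<delta> n U"
  obtains g h where "chi = g * h" "\<And>p. ev p \<in> U \<longleftrightarrow> g dvd p"
proof -
  note U' = W_submoduleD[OF U]
  note clos = coords.subspace_add[OF U'(1)] coords.subspace_diff[OF U'(1)] coords.subspace_scale[OF U'(1)]
  have ideal: "ev (r * p) \<in> U" if "ev p \<in> U" for r p
  proof (induction r)
    case 0
    show ?case using coords.subspace_0[OF U'(1)] by (simp add: ev_0)
  next
    case (pCons x r)
    have "ev (pCons x r * p) = vscale x (ev p) + A (ev (r * p))"
      by (simp add: ev_add ev_smult ev_shift)
    then show ?case using that pCons clos U'(3) by simp
  qed
  define P where "P g \<longleftrightarrow> g \<noteq> 0 \<and> ev g \<in> U" for g
  have "P chi" using coords.subspace_0[OF U'(1)] chi_monic by (simp add: P_def ev_chi)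
  then obtain g where g: "P g" "\<And>p. P p \<Longrightarrow> degree g \<le> degree p"
    by (metis arg_min_natI arg_min_nat_le)
  have mem: "ev p \<in> U \<longleftrightarrow> g dvd p" for p
  proof
    assume p: "ev p \<in> U"
    have "ev (p mod g) = ev p - ev (p div g * g)"
      by (simp flip: ev_diff add: minus_div_mult_eq_mod)
    then have "ev (p mod g) \<in> U" using p ideal g(1) clos by (simp add: P_def)
    then have "p mod g = 0"
      using g P_def degree_mod_less[of g p] by (metis leD)
    then show "g dvd p" by auto
  next
    assume "g dvd p"
    then show "ev p \<in> U" using ideal g(1) by (metis P_def dvd_def mult.commute)
  qed
  have "g dvd chi" using mem[of chi] coords.subspace_0[OF U'(1)] by (simp add: ev_chi)
  then show ?thesis using that mem by (metis dvd_def)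
qed

end

section \<open>Propagation of eigenvalues\<close>

context W_module
begin

definition th :: "'a \<Rightarrow> 'a" where "th y = y + 1 / y"

text \<open>A representative of the eigenvector of A with eigenvalue s\<close>

definition kap :: "'a \<Rightarrow> 'a poly" where "kap s = chi div [:- s, 1:]"

text \<open>In terms of the eigenvector e for \<open>th y\<close>:
  \<open>(A - th (y * q^2)) B e\<close> is a multiple of e. The argument is \<open>y\<close> rather
  than the eigenvalue, because \<open>y\<close> and \<open>1 / y\<close> share the eigenvalue but
  not the shifted value \<open>th (y * q^2)\<close>.\<close>

definition marginal :: "'a \<Rightarrow> bool" where
  "marginal y \<longleftrightarrow> (\<exists>\<xi>. chi dvd [:- th (y * q^2), 1:] * Dop (kap (th y)) - smult \<xi> (kap (th y)))"

lemma chi_kap: "poly chi s = 0 \<Longrightarrow> chi = [:- s, 1:] * kap s"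
  by (simp add: kap_def poly_eq_0_iff_dvd del: mult_pCons_left)

lemma kap_nonzero: "poly chi s = 0 \<Longrightarrow> kap s \<noteq> 0"
  using chi_kap chi_monic(3) by fastforce

lemma order_kap: "poly chi s = 0 \<Longrightarrow> order s chi = Suc (order s (kap s))"
  using chi_kap[of s] kap_nonzero[of s] chi_monic(3)
  by (metis order_mult order_power_n_n power_one_right plus_1_eq_Suc)

lemma th_neighbours:
  assumes "y \<noteq> 0"
  shows "th (y * q^2) + th (y / q^2) = Q * th y"
    and "th (y * q^2) * th (y / q^2) = (th y)^2 + \<rho>"
  using assms q_nonzero unfolding th_def Q_def \<rho>_def
  by (simp add: divide_simps, algebra)+

text \<open>The quadratic that the relation produces on an eigenvector for \<open>th y\<close> has
  the two neighbouring eigenvalues as roots.\<close>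

lemma quadratic_factor:
  assumes "y \<noteq> 0"
  shows "[:0, 0, 1:] * p - smult Q ([:0, 1:] * smult (th y) p) + smult ((th y)^2) p + smult \<rho> p
       = [:- th (y * q^2), 1:] * ([:- th (y / q^2), 1:] * p)"
proof -
  have "[:- th (y * q^2), 1:] * [:- th (y / q^2), 1:]
      = [:th (y * q^2) * th (y / q^2), - (th (y * q^2) + th (y / q^2)), 1:]"
    by simp
  also have "\<dots> = [:0, 0, 1:] - smult (Q * th y) [:0, 1:] + [:(th y)^2 + \<rho>:]"
    unfolding th_neighbours[OF assms] by simp
  finally have "[:- th (y * q^2), 1:] * ([:- th (y / q^2), 1:] * p)
      = ([:0, 0, 1:] - smult (Q * th y) [:0, 1:] + [:(th y)^2 + \<rho>:]) * p"
    by (metis mult.assoc)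
  also have "\<dots> = [:0, 0, 1:] * p - smult (Q * th y) ([:0, 1:] * p) + smult ((th y)^2 + \<rho>) p"
    by (simp add: ring_distribs smult_add_left left_diff_distrib del: mult_pCons_left) (simp add: smult_add_left)
  finally show ?thesis by (simp add: smult_add_left mult.commute algebra_simps)
qed

text \<open>On the eigenvector, every A to the right of B becomes the scalar \<open>th y\<close>,
  and the remaining quadratic in A factors.\<close>

lemma Dop_kap:
  assumes "poly chi (th y) = 0" "y \<noteq> 0"
  obtains r where "chi dvd [:- th (y * q^2), 1:] * ([:- th (y / q^2), 1:] * Dop (kap (th y))) - smult r (kap (th y))"
proof -
  define s where "s = th y"
  define e where "e = kap s"
  have xe: "[:0, 1:] * e = chi * 1 + smult s e"
    using chi_kap[of s] assms(1) by (simp add: e_def s_def)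
  have "[:0, 0, 1:] * e = [:0, 1:] * ([:0, 1:] * e)" by simp
  also have "\<dots> = [:0, 1:] * (chi * 1 + smult s e)" by (simp only: xe)
  also have "\<dots> = chi * [:0, 1:] + smult s ([:0, 1:] * e)" by (simp add: algebra_simps)
  also have "\<dots> = chi * [:0, 1:] + smult s (chi * 1 + smult s e)" by (simp only: xe)
  also have "\<dots> = chi * [:s, 1:] + smult (s^2) e"
    by (simp add: smult_add_right power2_eq_square)
  finally have xxe: "[:0, 0, 1:] * e = chi * [:s, 1:] + smult (s^2) e" .
  have D1: "Dop ([:0, 1:] * e) = smult s (Dop e)"
    unfolding xe Dop_add Dop_chi Dop_smult by simp
  have D2: "Dop ([:0, 0, 1:] * e) = smult (s^2) (Dop e)"
    unfolding xxe Dop_add Dop_chi Dop_smult by simp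
  have "chi dvd [:0,0,1:] * Dop e - smult Q ([:0,1:] * smult s (Dop e)) + smult (s^2) (Dop e)
      + smult \<rho> (Dop e) - smult bet e + smult gam (chi * 1 + smult s e)"
    using relation_AAB_poly[of e] unfolding D1 D2 xe[symmetric] .
  also have "[:0,0,1:] * Dop e - smult Q ([:0,1:] * smult s (Dop e)) + smult (s^2) (Dop e)
      + smult \<rho> (Dop e) - smult bet e + smult gam (chi * 1 + smult s e)
     = ([:- th (y * q^2), 1:] * ([:- th (y / q^2), 1:] * Dop e) - smult (bet - gam * s) e) + chi * [:gam:]"
    unfolding quadratic_factor[OF assms(2), of "Dop e", folded s_def]
    by (simp add: smult_add_right smult_diff_left del: mult_pCons_left)
  finally have "chi dvd [:- th (y * q^2), 1:] * ([:- th (y / q^2), 1:] * Dop e) - smult (bet - gam * s) e"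
    by (simp only: dvd_add_left_iff dvd_triv_left)
  then show ?thesis using that unfolding e_def s_def by blast
qed

text \<open>Together with \<open>kap_mult_cong\<close> this says that the eigenspaces of A are
  lines, even at multiple roots of \<open>chi\<close>.\<close>

lemma chi_dvd_linear_mult:
  assumes "poly chi s = 0" "chi dvd [:- s, 1:] * v"
  obtains w where "v = kap s * w"
proof -
  have "[:- s, 1:] * kap s dvd [:- s, 1:] * v" using assms chi_kap by metis
  then have "kap s dvd v" by (subst (asm) dvd_mult_cancel_left) auto
  then show ?thesis using that by (metis dvdE)
qed

lemma kap_mult_cong:
  assumes "poly chi s = 0"
  shows "chi dvd kap s * w - smult (poly w s) (kap s)"
proof -
  have "[:- s, 1:] dvd w - [:poly w s:]"
    by (simp flip: poly_eq_0_iff_dvd)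
  then have "kap s * [:- s, 1:] dvd kap s * (w - [:poly w s:])" by (rule mult_dvd_mono[OF dvd_refl])
  moreover have "kap s * [:- s, 1:] = chi" using chi_kap[OF assms] by (simp only: mult.commute)
  moreover have "kap s * (w - [:r:]) = kap s * w - smult r (kap s)" for r
    by (simp add: algebra_simps)
  ultimately show ?thesis by simp
qed

lemma eigen_neighbour:
  assumes y: "y \<noteq> 0" "poly chi (th y) = 0" "poly chi (th (y / q^2)) = 0" "th (y / q^2) \<noteq> th y"
  obtains \<xi> w where "[:- th (y * q^2), 1:] * Dop (kap (th y)) - smult \<xi> (kap (th y)) = kap (th (y / q^2)) * w"
proof -
  define s sp sm where "s = th y" and "sp = th (y * q^2)" and "sm = th (y / q^2)"
  define e where "e = kap s"
  obtain r where r: "chi dvd [:- sp, 1:] * ([:- sm, 1:] * Dop e) - smult r e"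
    using Dop_kap[OF y(2,1)] unfolding s_def sp_def sm_def e_def by blast
  \<comment> \<open>On \<open>e\<close> the factor \<open>x - sm\<close> acts as the scalar
    \<open>s - sm\<close>, so this choice cancels \<open>r e\<close> and leaves a vector killed by
    \<open>A - sm\<close>.\<close>
  define \<xi> where "\<xi> = r / (s - sm)"
  have \<xi>: "\<xi> * (s - sm) = r" using y(4) by (simp add: \<xi>_def s_def sm_def)
  have "[:- sm, 1:] * ([:- sp, 1:] * Dop e - smult \<xi> e)
      = ([:- sp, 1:] * ([:- sm, 1:] * Dop e) - smult r e) - smult \<xi> ([:- s, 1:] * e)"
  proof -
    have 1: "[:- sm, 1:] * e = [:- s, 1:] * e + smult (s - sm) e"
      by (simp add: smult_diff_left)
    have "[:- sm, 1:] * ([:- sp, 1:] * Dop e - smult \<xi> e)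
        = [:- sp, 1:] * ([:- sm, 1:] * Dop e) - smult \<xi> ([:- sm, 1:] * e)"
      by (simp only: right_diff_distrib mult_smult_right mult.left_commute)
    then show ?thesis unfolding 1 smult_add_right smult_smult \<xi> by (simp only: diff_diff_add add.commute)
  qed
  moreover have "chi dvd smult \<xi> ([:- s, 1:] * e)"
    using chi_kap[OF y(2)] by (metis dvd_refl dvd_smult e_def s_def)
  ultimately have "chi dvd [:- sm, 1:] * ([:- sp, 1:] * Dop e - smult \<xi> e)"
    using r by (simp only: dvd_diff)
  then obtain w where "[:- sp, 1:] * Dop e - smult \<xi> e = kap sm * w"
    using chi_dvd_linear_mult y(3) unfolding sm_def by blast
  then show ?thesis using that unfolding s_def sp_def sm_def e_def by blast
qed

text \<open>By \<open>kap_mult_cong\<close>, \<open>poly w sm\<close> is the coefficient of the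
  neighbouring eigenvector.\<close>

lemma marginalI:
  assumes "[:- th (y * q^2), 1:] * Dop (kap (th y)) - smult \<xi> (kap (th y)) = kap sm * w"
    and "poly chi sm = 0" "poly w sm = 0"
  shows "marginal y"
  unfolding marginal_def using assms kap_mult_cong[of sm w] by (intro exI[of _ \<xi>]) simp

end

text \<open>The roots of h and g are the eigenvalues of A on the submodule (g) and on its quotient.\<close>

locale W_ideal = W_module +
  fixes g h :: "'a poly"
  assumes gh: "chi = g * h"
    and Dop_ideal: "\<And>p. g dvd p \<Longrightarrow> g dvd Dop p"
begin

lemma root_split: "poly chi s = 0 \<longleftrightarrow> poly g s = 0 \<or> poly h s = 0"
  by (simp add: gh)

text \<open>\<open>kap s\<close> is \<open>g * h\<close> divided by x - s, a multiple of
  \<open>g\<close> exactly when that factor can be taken out of \<open>h\<close>.\<close>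

lemma g_dvd_kap_iff:
  assumes "poly chi s = 0"
  shows "g dvd kap s \<longleftrightarrow> poly h s = 0"
proof
  assume "g dvd kap s"
  then obtain u where "kap s = g * u" by (rule dvdE)
  then have "g * h = g * ([:- s, 1:] * u)" using chi_kap[OF assms] gh by (simp only: mult.left_commute)
  moreover have "g \<noteq> 0" using gh chi_monic(3) by auto
  ultimately have "h = [:- s, 1:] * u" by (metis mult_left_cancel)
  then show "poly h s = 0" by simp
next
  assume "poly h s = 0"
  then obtain u where "h = [:- s, 1:] * u" by (auto simp: poly_eq_0_iff_dvd elim: dvdE)
  then have "[:- s, 1:] * kap s = [:- s, 1:] * (g * u)" using chi_kap[OF assms] gh by (simp only: mult.left_commute)
  then have "kap s = g * u" by (subst (asm) mult_cancel_left) auto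
  then show "g dvd kap s" by simp
qed

text \<open>The eigenvector for \<open>th y\<close> lies in the submodule, hence so does the
  multiple of the neighbouring eigenvector that B produces; without marginality this multiple is
  nonzero.\<close>

lemma h_root_step:
  assumes y: "y \<noteq> 0" "poly h (th y) = 0" "poly chi (th (y / q^2)) = 0" and nm: "\<not> marginal y"
  shows "poly h (th (y / q^2)) = 0"
proof (cases "th (y / q^2) = th y")
  case False
  define sm where "sm = th (y / q^2)"
  have chi0: "poly chi (th y) = 0" using y root_split by simp
  obtain \<xi> w where w: "[:- th (y * q^2), 1:] * Dop (kap (th y)) - smult \<xi> (kap (th y)) = kap sm * w"
    using eigen_neighbour[OF y(1) chi0 y(3) False] unfolding sm_def by metis
  have "g dvd kap (th y)" using y chi0 g_dvd_kap_iff by simp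
  then have "g dvd kap sm * w" unfolding w[symmetric] by (intro dvd_diff dvd_mult dvd_smult Dop_ideal)
  moreover have "g dvd kap sm * w - smult (poly w sm) (kap sm)"
    using kap_mult_cong[of sm w] y(3) gh by (metis sm_def dvd_mult_left)
  ultimately have "g dvd smult (poly w sm) (kap sm)"
    by (metis dvd_diff diff_diff_eq2 add_diff_cancel_left')
  moreover have "poly w sm \<noteq> 0" using marginalI[OF w] nm y(3) sm_def by auto
  ultimately have "g dvd kap sm" by (simp add: dvd_smult_iff)
  then show ?thesis using g_dvd_kap_iff y(3) sm_def by simp
qed (use y in simp)

section \<open>Roots shared by \<open>g\<close> and \<open>h\<close>, with multiplicities\<close>

lemma order_split: "order s chi = order s g + order s h"
  using gh chi_monic(3) by (simp add: order_mult)

lemma both_roots_order: "poly g s = 0 \<Longrightarrow> poly h s = 0 \<Longrightarrow> 2 \<le> order s chi"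
  using order_split[of s] gh chi_monic(3) by (auto simp: order_root)

lemma linear_power_dvd_cancel:
  assumes "[:- x, 1:] ^ k dvd p * r" "poly p x \<noteq> 0"
  shows "[:- x, 1:] ^ k dvd (r :: 'a poly)"
proof (cases "r = 0")
  case False
  moreover have "p \<noteq> 0" using assms(2) by auto
  ultimately show ?thesis
    using assms order_mult[of p r x] order_0I[OF assms(2)] by (simp add: order_divides)
qed simp

text \<open>At a double root \<open>sm\<close> of \<open>chi\<close>, \<open>kap sm\<close> vanishes
  only once, so divisibility by the square forces the coefficient of the neighbouring eigenvector to
  be 0.\<close>

lemma marginal_of_double:
  assumes y: "y \<noteq> 0" "poly chi (th y) = 0" and sm: "sm = th (y / q^2)" "sm \<noteq> th y"
    and ord: "order sm chi = 2"
    and dvd: "[:- sm, 1:]^2 dvd [:- th (y * q^2), 1:] * Dop (kap (th y))"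
  shows "marginal y"
proof -
  have sm0: "poly chi sm = 0" using ord by (simp add: order_root)
  obtain \<xi> w where w: "[:- th (y * q^2), 1:] * Dop (kap (th y)) - smult \<xi> (kap (th y)) = kap sm * w"
    using eigen_neighbour[OF y(1,2)] sm sm0 by metis
  have "[:- sm, 1:]^2 dvd [:- th y, 1:] * kap (th y)"
    using chi_kap[OF y(2)] ord chi_monic(3) by (metis order_divides order_refl)
  then have "[:- sm, 1:]^2 dvd kap (th y)"
    by (rule linear_power_dvd_cancel) (use sm in simp)
  then have "[:- sm, 1:]^2 dvd kap sm * w" unfolding w[symmetric] using dvd by (intro dvd_diff dvd_smult)
  moreover have "order sm (kap sm) = 1" using order_kap[OF sm0] ord by simp
  ultimately have "1 \<le> order sm w" if "w \<noteq> 0"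
    using kap_nonzero[OF sm0] that order_mult[of "kap sm" w sm] by (simp add: order_divides)
  then have "poly w sm = 0" by (cases "w = 0") (auto simp: order_root)
  then show ?thesis using marginalI[OF w sm0] by simp
qed

text \<open>If \<open>th y\<close> were not a root of \<open>g\<close>, the divisibility required by
  \<open>marginal_of_double\<close> would hold.\<close>

lemma g_root_step:
  assumes y: "y \<noteq> 0" "poly h (th y) = 0" and sm: "sm = th (y / q^2)"
    and g0: "poly g sm = 0" and h0: "poly h sm = 0" and ord: "order sm chi \<le> 2"
    and sm_nonfix: "(y / q^2)^2 \<noteq> 1"
    and double: "y^2 \<noteq> 1 \<Longrightarrow> 2 \<le> order (th y) chi"
    and nm: "\<not> marginal y"
  shows "poly g (th y) = 0"
proof (rule ccontr)
  assume ng: "poly g (th y) \<noteq> 0"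
  define s sp where "s = th y" and "sp = th (y * q^2)"
  define P where "P = [:- sm, 1:]^2"
  have chi0: "poly chi s = 0" using y root_split s_def by simp
  have sm_s: "sm \<noteq> s" using ng g0 s_def by auto
  have ord2: "order sm chi = 2" using both_roots_order[OF g0 h0] ord by simp
  have P_chi: "P dvd chi" using ord2 chi_monic(3) unfolding P_def by (simp add: order_divides)
  have sm_dvd: "[:- sm, 1:] dvd Dop p" if "g dvd p" for p
    using Dop_ideal[OF that] g0 by (metis dvd_trans poly_eq_0_iff_dvd)
  have P_sm: "P dvd [:- sm, 1:] * p" if "[:- sm, 1:] dvd p" for p
    using that unfolding P_def power2_eq_square by (rule mult_dvd_mono[OF dvd_refl])
  have g_kap: "g dvd kap s" using y chi0 g_dvd_kap_iff s_def by simp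
  have "P dvd [:- sp, 1:] * Dop (kap s)"
  proof (cases "y^2 = 1")
    \<comment> \<open>Now \<open>y = 1 / y\<close>, so both neighbours coincide:
      \<open>x - sp\<close> supplies one power of \<open>x - sm\<close> and \<open>g\<close> the
      other.\<close>
    case True
    then have "1 / y = y" using y(1) by (simp add: field_simps power2_eq_square)
    then have "1 / (y * q^2) = y / q^2" "1 / (y / q^2) = y * q^2"
      using y(1) q_nonzero True by (auto simp: field_simps power2_eq_square)
    then have "sp = sm" unfolding sp_def sm th_def by simp
    then show ?thesis using P_sm sm_dvd g_kap by simp
  next
    case False
    have "order s g = 0" using ng s_def by (intro order_0I) simp
    then have "2 \<le> order s h" using order_split[of s] double[OF False] s_def by simp
    then have "[:- s, 1:]^2 dvd h" by (simp add: order_divides)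
    then obtain u where u: "h = [:- s, 1:]^2 * u" by (rule dvdE)
    \<comment> \<open>A generalised eigenvector: \<open>A - s\<close> sends it to \<open>e\<close>.
      It lies in the submodule because the double root \<open>s\<close> belongs to
      \<open>h\<close>.\<close>
    define f where "f = g * u"
    define e where "e = kap s"
    have chi_f: "chi = [:- s, 1:]^2 * f" unfolding gh u f_def by (simp only: mult.left_commute)
    then have "[:- s, 1:] * e = [:- s, 1:] * ([:- s, 1:] * f)"
      using chi_kap[OF chi0] unfolding e_def by (simp only: power2_eq_square mult.assoc)
    then have e_f: "e = [:- s, 1:] * f" by (subst (asm) mult_cancel_left) auto
    have xf: "[:0, 1:] * f = e + smult s f" unfolding e_f by simp
    have xe: "[:0, 1:] * e = chi * 1 + smult s e" using chi_kap[OF chi0] by (simp add: e_def)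
    have "[:0, 0, 1:] * f = [:0, 1:] * ([:0, 1:] * f)" by simp
    also have "\<dots> = [:0, 1:] * (e + smult s f)" by (simp only: xf)
    also have "\<dots> = [:0, 1:] * e + smult s ([:0, 1:] * f)" by (simp only: distrib_left mult_smult_right)
    also have "\<dots> = chi * 1 + smult s e + smult s (e + smult s f)" unfolding xe xf ..
    also have "\<dots> = chi * 1 + smult (2 * s) e + smult (s^2) f"
      by (simp only: smult_add_right power2_eq_square mult_2 smult_add_left smult_smult add.assoc)
    finally have xxf: "[:0, 0, 1:] * f = chi * 1 + smult (2 * s) e + smult (s^2) f" .
    have D1: "Dop ([:0, 1:] * f) = Dop e + smult s (Dop f)"
      unfolding xf Dop_add Dop_smult ..
    have D2: "Dop ([:0, 0, 1:] * f) = smult (2 * s) (Dop e) + smult (s^2) (Dop f)"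
      unfolding xxf Dop_add Dop_chi Dop_smult by simp
    have "chi dvd [:0,0,1:] * Dop f - smult Q ([:0,1:] * (Dop e + smult s (Dop f)))
        + (smult (2 * s) (Dop e) + smult (s^2) (Dop f)) + smult \<rho> (Dop f) - smult bet f + smult gam ([:0, 1:] * f)"
      using relation_AAB_poly[of f] unfolding D1 D2 .
    also have "[:0,0,1:] * Dop f - smult Q ([:0,1:] * (Dop e + smult s (Dop f)))
        + (smult (2 * s) (Dop e) + smult (s^2) (Dop f)) + smult \<rho> (Dop f) - smult bet f + smult gam ([:0, 1:] * f)
       = ([:0,0,1:] * Dop f - smult Q ([:0,1:] * smult s (Dop f)) + smult (s^2) (Dop f) + smult \<rho> (Dop f))
         + (smult (2 * s) (Dop e) - smult Q ([:0,1:] * Dop e)) + (smult gam ([:0, 1:] * f) - smult bet f)"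
      by (simp only: distrib_left smult_add_right) (simp only: algebra_simps)
    \<comment> \<open>The factor of \<open>Dop e\<close> is the derivative with respect to
      \<open>s\<close> of \<open>x^2 - Q s x + s^2 + \<rho>\<close>. The other two terms will be
      multiples of \<open>P\<close>, so \<open>P\<close> must divide this one.\<close>
    also have "\<dots> = [:- sp, 1:] * ([:- sm, 1:] * Dop f) + [:2 * s, - Q:] * Dop e + [:- bet, gam:] * f"
      unfolding s_def sp_def sm quadratic_factor[OF y(1)]
      by (simp add: algebra_simps)
    finally have "P dvd [:- sp, 1:] * ([:- sm, 1:] * Dop f) + [:2 * s, - Q:] * Dop e + [:- bet, gam:] * f"
      using P_chi dvd_trans by blast
    moreover have "P dvd [:- bet, gam:] * f"
    proof -
      have "P dvd f"
        unfolding P_def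
        by (rule linear_power_dvd_cancel[of _ _ "[:- s, 1:]^2"]) (use P_chi chi_f sm_s P_def in auto)
      then show ?thesis by (rule dvd_mult)
    qed
    moreover have "P dvd [:- sp, 1:] * ([:- sm, 1:] * Dop f)"
      by (rule dvd_mult[OF P_sm[OF sm_dvd]]) (simp add: f_def)
    ultimately have "P dvd [:2 * s, - Q:] * Dop e"
      by (metis dvd_add_left_iff dvd_add_right_iff)
    moreover have "poly [:2 * s, - Q:] sm \<noteq> 0"
    proof -
      define z where "z = y / q^2"
      have z: "z \<noteq> 0" "y = z * q^2" using y(1) q_nonzero by (auto simp: z_def)
      have "2 * s - Q * sm = (q^2 - 1/q^2) * (z - 1/z)"
        unfolding s_def sm z_def[symmetric] unfolding z(2) th_def Q_def using z(1) q_nonzero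
        by (simp add: divide_simps) algebra
      moreover have "q^2 - 1/q^2 \<noteq> 0"
        using q4 q_nonzero by (simp add: field_simps flip: power_add)
      moreover have "z - 1/z \<noteq> 0" using sm_nonfix z(1) unfolding z_def[symmetric] by (simp add: field_simps power2_eq_square)
      ultimately have "2 * s - Q * sm \<noteq> 0" by simp
      then show ?thesis by (simp add: algebra_simps)
    qed
    ultimately have "P dvd Dop e" unfolding P_def by (rule linear_power_dvd_cancel)
    then show ?thesis unfolding e_def by (rule dvd_mult)
  qed
  then have "marginal y"
    using marginal_of_double[OF y(1) _ sm _ ord2] chi0 sm_s unfolding P_def s_def sp_def by blast
  then show False using nm by contradiction
qed

text \<open>The neighbour is the eigenvalue itself, so \<open>eigen_neighbour\<close> does not
  apply. Comparing multiplicities at \<open>s\<close> in \<open>Dop_kap\<close> forces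
  \<open>r = 0\<close>; then \<open>A - s\<close> kills \<open>(A - sp) B e\<close>, which is
  therefore a multiple of \<open>e\<close>.\<close>

lemma marginal_at_reflection:
  assumes y: "y \<noteq> 0" and refl: "th (y / q^2) = th y"
    and g0: "poly g (th y) = 0" and h0: "poly h (th y) = 0" and ord: "order (th y) chi \<le> 2"
  shows "marginal y"
proof -
  define s sp where "s = th y" and "sp = th (y * q^2)"
  define e where "e = kap s"
  define P where "P = [:- s, 1:]^2"
  have chi0: "poly chi s = 0" using g0 root_split s_def by simp
  have ord2: "order s chi = 2" using both_roots_order[OF g0 h0] ord s_def by simp
  have P_chi: "P dvd chi" using ord2 chi_monic(3) unfolding P_def by (simp add: order_divides)
  obtain r where r: "chi dvd [:- sp, 1:] * ([:- s, 1:] * Dop e) - smult r e"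
    using Dop_kap[OF _ y] chi0 refl unfolding s_def sp_def e_def by metis
  have "g dvd e" using h0 chi0 g_dvd_kap_iff s_def e_def by simp
  then have "[:- s, 1:] dvd Dop e" using Dop_ideal g0 s_def by (metis dvd_trans poly_eq_0_iff_dvd)
  then have "P dvd [:- sp, 1:] * ([:- s, 1:] * Dop e)"
    unfolding P_def power2_eq_square by (intro dvd_mult mult_dvd_mono dvd_refl)
  moreover have "P dvd [:- sp, 1:] * ([:- s, 1:] * Dop e) - smult r e" using P_chi r by (rule dvd_trans)
  ultimately have "P dvd smult r e" by (metis dvd_diff diff_diff_eq2 add_diff_cancel_left')
  moreover have "\<not> P dvd e"
    using order_kap[OF chi0] ord2 kap_nonzero[OF chi0] by (simp add: P_def e_def order_divides)
  ultimately have "r = 0" using dvd_smult_cancel by blast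
  then have "chi dvd [:- s, 1:] * ([:- sp, 1:] * Dop e)" using r by (simp only: smult_0_left diff_zero mult.left_commute)
  then obtain w where w: "[:- sp, 1:] * Dop e = kap s * w" using chi_dvd_linear_mult[OF chi0] by blast
  then have "chi dvd [:- sp, 1:] * Dop e - smult (poly w s) (kap s)"
    using kap_mult_cong[OF chi0] by simp
  then show ?thesis unfolding marginal_def e_def s_def sp_def by blast
qed

end

section \<open>The spectrum of A\<close>

text \<open>Over a finite field, the product of all x - a, plus 1, would have no root.\<close>

lemma alg_closed_infinite:
  assumes "alg_closed TYPE('a::field)"
  shows "infinite (UNIV :: 'a set)"
proof
  assume fin: "finite (UNIV :: 'a set)"
  define p where "p = (\<Prod>x\<in>(UNIV :: 'a set). [:- x, 1:])"
  have "degree p = card (UNIV :: 'a set)"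
    unfolding p_def by (subst degree_prod_eq_sum_degree) auto
  then have "0 < degree p" using fin by (simp add: card_gt_0_iff)
  moreover have "degree (p + 1) = degree p"
    using \<open>0 < degree p\<close> by (intro degree_add_eq_left) simp
  ultimately obtain x where x: "poly (p + 1) x = 0"
    using assms unfolding alg_closed_def by metis
  have "poly p x = 0"
    using fin unfolding p_def poly_prod by (intro prod_zero) (auto intro: bexI[of _ x])
  then show False using x by simp
qed

text \<open>As polynomials in \<open>y\<close>, both sides are monic of degree \<open>n\<close> and
  vanish at the \<open>n\<close> distinct points \<open>t * \<omega> ^ i\<close>.\<close>

lemma prod_primitive_root:
  fixes \<omega> t y :: "'a::field"
  assumes "0 < n" "\<omega> ^ n = 1" "\<And>k. 0 < k \<Longrightarrow> k < n \<Longrightarrow> \<omega> ^ k \<noteq> 1" "t \<noteq> 0"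
  shows "(\<Prod>i<n. y - t * \<omega> ^ i) = y ^ n - t ^ n"
proof -
  define p where "p = (\<Prod>i<n. [:- (t * \<omega> ^ i), 1:])"
  define r where "r = monom 1 n - [:t ^ n:]"
  have \<omega>: "\<omega> \<noteq> 0" using assms by (auto simp: zero_power)
  have inj: "inj_on (\<lambda>i. t * \<omega> ^ i) {..<n}"
  proof (rule linorder_inj_onI)
    fix i j assume ij: "i < j" "i \<in> {..<n}" "j \<in> {..<n}"
    have "\<omega> ^ (j - i) \<noteq> 1" using ij assms(3) by simp
    moreover have "\<omega> ^ j = \<omega> ^ i * \<omega> ^ (j - i)" using ij by (simp flip: power_add)
    ultimately show "t * \<omega> ^ i \<noteq> t * \<omega> ^ j" using \<omega> assms(4) by simp
  qed auto
  have dp: "degree p = n"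
    unfolding p_def by (subst degree_prod_eq_sum_degree) auto
  have "coeff p n = 1"
  proof -
    have "lead_coeff p = 1" unfolding p_def lead_coeff_prod by simp
    then show ?thesis using dp by simp
  qed
  moreover have "coeff r n = 1" using assms(1) coeff_eq_0[of "[:t^n:]" n] by (simp add: r_def)
  moreover have "degree r \<le> n" unfolding r_def by (intro degree_diff_le) (auto simp: degree_monom_le)
  moreover have "poly p z = poly r z" if "z \<in> (\<lambda>i. t * \<omega> ^ i) ` {..<n}" for z
  proof -
    from that obtain i where i: "i < n" "z = t * \<omega> ^ i" by auto
    have "poly p z = 0" unfolding p_def poly_prod using i by (intro prod_zero) auto
    moreover have "z ^ n = t ^ n"
      unfolding i by (simp add: power_mult_distrib assms(2) flip: power_mult) (simp add: mult.commute[of i] power_mult assms(2))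
    ultimately show ?thesis by (simp add: r_def poly_monom)
  qed
  ultimately have "p = r"
    using dp card_image[OF inj] by (intro poly_eqI_degree_lead_coeff[of p n r "(\<lambda>i. t * \<omega> ^ i) ` {..<n}"]) auto
  then have "poly p y = poly r y" by simp
  then show ?thesis by (simp add: p_def r_def poly_prod poly_monom)
qed

context W_module
begin

text \<open>Each factor is \<open>(y - t q^(2i)) (y - q^(-2i) / t) / y\<close>, and
  \<open>prod_primitive_root\<close> evaluates both products.\<close>

lemma prod_th:
  assumes "y \<noteq> 0" "t \<noteq> 0"
  shows "(\<Prod>i<n. th y - th (t * X i)) = y ^ n + 1 / y ^ n - t ^ n - 1 / t ^ n"
proof -
  have q2: "(q^2)^k \<noteq> 0" for k using q_nonzero by simp
  have "th y - th (t * X i) = (y - t * (q^2) ^ i) * (y - 1 / t * (1 / q^2) ^ i) / y" for i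
    using assms q2[of i] by (simp add: th_def X_def power_one_over field_simps)
  then have "(\<Prod>i<n. th y - th (t * X i))
      = (\<Prod>i<n. y - t * (q^2) ^ i) * (\<Prod>i<n. y - 1 / t * (1 / q^2) ^ i) / y ^ n"
    by (simp add: prod.distrib prod_dividef)
  also have "(\<Prod>i<n. y - t * (q^2) ^ i) = y ^ n - t ^ n"
    using n_ge q_pow_n q_pow_less assms by (intro prod_primitive_root) auto
  also have "(\<Prod>i<n. y - 1 / t * (1 / q^2) ^ i) = y ^ n - (1 / t) ^ n"
    using n_ge q_pow_n q_pow_less assms by (intro prod_primitive_root) (auto simp: power_one_over)
  also have "(y ^ n - t ^ n) * (y ^ n - (1 / t) ^ n) / y ^ n = y ^ n + 1 / y ^ n - t ^ n - 1 / t ^ n"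
    using assms by (simp add: field_simps power_one_over)
  finally show ?thesis .
qed

lemma theta_th: "\<theta> k = th (a / l * X k)"
  by (simp add: theta_X T_def th_def)

lemma poly_chi: "poly chi x = (\<Prod>i<n. x - \<theta> i) - \<delta>"
  by (simp add: chi_def newton_def poly_prod)

lemma th_eq_iff: "y \<noteq> 0 \<Longrightarrow> z \<noteq> 0 \<Longrightarrow> th y = th z \<longleftrightarrow> y = z \<or> y * z = 1"
proof -
  assume yz: "y \<noteq> 0" "z \<noteq> 0"
  then have "th y - th z = (y - z) * (y * z - 1) / (y * z)"
    by (simp add: th_def field_simps)
  then have "th y - th z = 0 \<longleftrightarrow> (y - z) = 0 \<or> (y * z - 1) = 0" using yz by simp
  then show ?thesis by simp
qed

lemma X_inj: "inj_on X {..<n}"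
proof (rule linorder_inj_onI)
  fix i j assume ij: "i < j" "i \<in> {..<n}" "j \<in> {..<n}"
  have "(q^2) ^ (j - i) \<noteq> 1" using ij q_pow_less by simp
  moreover have "X j = X i * (q^2) ^ (j - i)" using ij by (simp add: X_def flip: power_add)
  ultimately show "X i \<noteq> X j" using X_nonzero[of i] by simp
qed auto

lemma X_add: "X (i + j) = X i * X j" by (simp add: X_def power_add)

lemma X_mod: "X (i mod n) = X i"
proof -
  have "X i = X (i mod n + n * (i div n))" by simp
  also have "\<dots> = X (i mod n)" unfolding X_add by (simp add: X_def power_mult q_pow_n)
  finally show ?thesis ..
qed

lemma X_n: "X n = 1" by (simp add: X_def q_pow_n)

end

lemma order_prod_linear:
  assumes "finite I"
  shows "order (s :: 'a::field) (\<Prod>i\<in>I. [:- f i, 1:]) = card {i \<in> I. f i = s}"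
  using assms
proof (induction I rule: finite_induct)
  case (insert i I)
  have "(\<Prod>i\<in>I. [:- f i, 1:]) \<noteq> 0" using insert by (simp add: prod_zero_iff)
  then have "order s (\<Prod>i\<in>insert i I. [:- f i, 1:]) = order s [:- f i, 1:] + card {i \<in> I. f i = s}"
    using insert by (simp add: order_mult del: mult_pCons_left)
  moreover have "order s [:- f i, 1:] = (if f i = s then 1 else 0)"
    using order_power_n_n[of s 1] by (auto intro!: order_0I)
  moreover have "{j \<in> insert i I. f j = s} = (if f i = s then insert i {j \<in> I. f j = s} else {j \<in> I. f j = s})"
    by auto
  ultimately show ?case using insert by simp
qed simp

locale W_spectrum = W_module +
  fixes \<nu> :: 'a
  assumes alg_closed: "alg_closed TYPE('a)" and nu: "\<nu> \<noteq> 0"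
    and nu_eq: "\<nu> ^ n + 1 / \<nu> ^ n = \<delta> + (a / l) ^ n + 1 / (a / l) ^ n"
begin

definition u where "u i = X i / \<nu>"

lemma u_nonzero: "u i \<noteq> 0" using nu X_nonzero by (simp add: u_def)

text \<open>Writing the argument as \<open>th y\<close> turns both sides into
  \<open>y^n + 1 / y^n\<close> minus a constant; the condition on \<open>\<nu>\<close> equates the
  constants.\<close>

lemma chi_prod: "chi = (\<Prod>i<n. [:- th (u i), 1:])"
proof -
  have eq: "poly chi x = poly (\<Prod>i<n. [:- th (u i), 1:]) x" for x
  proof -
    obtain y where y: "poly [:1, - x, 1:] y = 0"
      using alg_closed unfolding alg_closed_def by (metis degree_pCons_eq one_neq_zero pCons_eq_0_iff zero_less_Suc)
    then have y0: "y \<noteq> 0" by auto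
    have "x = th y" using y y0 by (simp add: th_def field_simps)
    moreover have "poly chi (th y) = y ^ n + 1 / y ^ n - (a / l) ^ n - 1 / (a / l) ^ n - \<delta>"
      unfolding poly_chi theta_th using prod_th[OF y0, of "a / l"] nonzero by simp
    moreover have "poly (\<Prod>i<n. [:- th (u i), 1:]) (th y) = y ^ n + 1 / y ^ n - (\<nu> ^ n + 1 / \<nu> ^ n)"
      using prod_th[OF y0, of "1 / \<nu>"] nu by (simp add: poly_prod u_def power_one_over)
    ultimately show ?thesis unfolding nu_eq by simp
  qed
  obtain I :: "'a set" where I: "finite I" "card I = Suc n"
    using infinite_arbitrarily_large[OF alg_closed_infinite[OF alg_closed]] by blast
  have "degree (\<Prod>i<n. [:- th (u i), 1:]) = n"
    by (subst degree_prod_eq_sum_degree) auto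
  then show ?thesis
    using eq I chi_monic(1) by (intro poly_eqI_degree[of I]) auto
qed

lemma order_chi: "order s chi = card {i. i < n \<and> th (u i) = s}"
  unfolding chi_prod using order_prod_linear[of "{..<n}" s "\<lambda>i. th (u i)"] by simp

lemma root_chi: "poly chi s = 0 \<longleftrightarrow> (\<exists>i<n. s = th (u i))"
  unfolding chi_prod poly_prod by (auto simp: prod_zero_iff)

lemma u_mod: "u (i mod n) = u i" by (simp add: u_def X_mod)

lemma root_u: "poly chi (th (u i)) = 0"
  unfolding root_chi using u_mod[of i] n_ge by (intro exI[of _ "i mod n"]) simp

lemma u_inj: "inj_on u {..<n}"
  using X_inj nu by (auto simp: inj_on_def u_def)

lemma card_u_le: "card {i. i < n \<and> u i = y} \<le> 1"
proof -
  have "card {i. i < n \<and> u i = y} = card (u ` {i. i < n \<and> u i = y})"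
    using u_inj by (intro card_image[symmetric]) (auto simp: inj_on_def)
  also have "\<dots> \<le> card {y}" by (intro card_mono) auto
  finally show ?thesis by simp
qed

text \<open>Only indices with \<open>u i = y\<close> or \<open>u i = 1 / y\<close> contribute, at
  most one of each kind; for \<open>y^2 = 1\<close> the two kinds coincide.\<close>

lemma order_chi_le:
  assumes "y \<noteq> 0"
  shows "order (th y) chi \<le> 2" and "y^2 = 1 \<Longrightarrow> order (th y) chi \<le> 1"
proof -
  have eq: "{i. i < n \<and> th (u i) = th y} = {i. i < n \<and> u i = y} \<union> {i. i < n \<and> u i = 1 / y}"
    using assms u_nonzero by (auto simp: th_eq_iff field_simps)
  have "card {i. i < n \<and> th (u i) = th y} \<le> card {i. i < n \<and> u i = y} + card {i. i < n \<and> u i = 1 / y}"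
    unfolding eq by (rule card_Un_le)
  then show "order (th y) chi \<le> 2"
    unfolding order_chi using card_u_le[of y] card_u_le[of "1 / y"] by linarith
  assume "y^2 = 1"
  then have "1 / y = y" using assms by (simp add: field_simps power2_eq_square)
  then show "order (th y) chi \<le> 1" unfolding order_chi eq using card_u_le[of y] by simp
qed

lemma u_Suc: "u (Suc i) / q^2 = u i"
  using q_nonzero by (simp add: u_def X_def)

lemma inverse_u_Suc: "1 / u i / q^2 = 1 / u (Suc i)"
  using q_nonzero by (simp add: u_def X_def)

lemma th_inverse: "th (1 / y) = th y"
  by (simp add: th_def)

lemma marginal_exists:
  assumes gh: "chi = g * h" and D: "\<And>p. g dvd p \<Longrightarrow> g dvd Dop p"
    and g: "\<not> is_unit g" and h: "\<not> is_unit h"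
  shows "\<exists>y. y \<noteq> 0 \<and> poly h (th y) = 0 \<and> marginal y"
proof (rule ccontr)
  assume "\<not> ?thesis"
  then have nm: "\<not> marginal y" if "y \<noteq> 0" "poly h (th y) = 0" for y using that by blast
  interpret W_ideal q a b c l \<delta> n g h
    by unfold_locales (use gh D in auto)
  have gh0: "g \<noteq> 0" "h \<noteq> 0" using gh chi_monic(3) by auto
  have root: "\<exists>i<n. poly p (th (u i)) = 0" if "p dvd chi" "\<not> is_unit p" "p \<noteq> 0" for p
  proof -
    have "0 < degree p" using that by (simp add: is_unit_iff_degree)
    then obtain x where x: "poly p x = 0" using alg_closed unfolding alg_closed_def by blast
    then have "poly chi x = 0" using that(1) by (metis dvd_def poly_mult mult_zero_left)
    then show ?thesis using x root_chi by auto
  qed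
  \<comment> \<open>Moving upwards is enough, because the indices are cyclic modulo
    \<open>n\<close>.\<close>
  have spread: "poly p (th (u j)) = 0"
    if "poly p (th (u i)) = 0" and step: "\<And>i. poly p (th (u i)) = 0 \<Longrightarrow> poly p (th (u (Suc i))) = 0"
    and "i < n" for p i j
  proof -
    have "poly p (th (u (i + k))) = 0" for k
      by (induction k) (use that in auto)
    from this[of "n - i + j"] have "poly p (th (u (n + j))) = 0" using that(3) by simp
    then show ?thesis by (metis mod_add_self1 u_mod)
  qed
  have h_all: "poly h (th (u j)) = 0" for j
  proof -
    obtain i where i: "i < n" "poly h (th (u i)) = 0" using root[of h] gh h gh0 by auto
    show ?thesis
    proof (rule spread[OF i(2) _ i(1)])
      fix i assume "poly h (th (u i)) = 0"
      \<comment> \<open>\<open>h_root_step\<close> divides by \<open>q^2\<close>; applied to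
        \<open>1 / u i\<close> it raises the index.\<close>
      then have "poly h (th (1 / u i)) = 0" unfolding th_inverse .
      moreover have "poly chi (th (1 / u i / q^2)) = 0" unfolding inverse_u_Suc th_inverse by (rule root_u)
      ultimately have "poly h (th (1 / u i / q^2)) = 0"
        using h_root_step[of "1 / u i"] nm u_nonzero by simp
      then show "poly h (th (u (Suc i))) = 0" unfolding inverse_u_Suc th_inverse .
    qed
  qed
  have collide: "order (th (u i)) chi = 2" if "poly g (th (u i)) = 0" for i
    using both_roots_order[OF that h_all] order_chi_le(1)[OF u_nonzero, of i] by simp
  obtain i0 where i0: "i0 < n" "poly g (th (u i0)) = 0" using root[of g] gh g gh0 by auto
  have "\<exists>j k. j < n \<and> k < n \<and> j \<noteq> k \<and> th (u j) = th (u k)"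
  proof -
    have "card {i. i < n \<and> th (u i) = th (u i0)} = 2" using collide[OF i0(2)] order_chi by simp
    then obtain j k where eq: "{i. i < n \<and> th (u i) = th (u i0)} = {j, k}" and "j \<noteq> k"
      unfolding card_2_iff by metis
    have "i < n \<and> th (u i) = th (u i0)" if "i \<in> {j, k}" for i
      using that unfolding eq[symmetric] by simp
    from this[of j] this[of k] \<open>j \<noteq> k\<close> show ?thesis
      by (intro exI[of _ j] exI[of _ k]) simp
  qed
  then obtain j k where jk: "j < n" "k < n" "j \<noteq> k" "th (u j) = th (u k)" by blast
  then have "u j * u k = 1" using u_inj u_nonzero th_eq_iff by (auto simp: inj_on_def)
  \<comment> \<open>Consequently the \<open>u i\<close> are closed under inversion: index
    \<open>i\<close> is paired with \<open>j + k - i\<close> modulo \<open>n\<close>.\<close>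
  then have nu2: "X (j + k) = \<nu>^2" using nu by (simp add: u_def X_add field_simps power2_eq_square)
  have double: "2 \<le> order (th (u i)) chi" if "(u i)^2 \<noteq> 1" for i
  proof -
    \<comment> \<open>\<open>n - i1\<close> replaces \<open>- i1\<close>, avoiding truncated
      subtraction.\<close>
    define i1 i2 where "i1 = i mod n" and "i2 = (j + k + (n - i1)) mod n"
    have less: "i1 < n" "i2 < n" using n_ge by (auto simp: i1_def i2_def)
    have "X i1 * X i2 = X (i1 + (j + k + (n - i1)))" unfolding i2_def X_mod X_add ..
    also have "\<dots> = X (j + k + n)" using less by (simp add: add.commute add.left_commute)
    also have "\<dots> = \<nu>^2" unfolding X_add[of "j + k"] nu2 X_n by simp
    finally have one: "u i1 * u i2 = 1" using nu by (simp add: u_def power2_eq_square)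
    have ui: "u i1 = u i" unfolding i1_def by (rule u_mod)
    have "i1 \<noteq> i2" using one that ui by (auto simp: power2_eq_square)
    moreover have "th (u i2) = th (u i)" using one ui u_nonzero th_eq_iff by (metis mult.commute)
    ultimately have "card {i1, i2} \<le> card {m. m < n \<and> th (u m) = th (u i)}"
      using less ui by (intro card_mono) auto
    then show ?thesis using \<open>i1 \<noteq> i2\<close> unfolding order_chi by simp
  qed
  have g_all: "poly g (th (u j)) = 0" for j
  proof (rule spread[OF i0(2) _ i0(1)])
    fix i assume gi: "poly g (th (u i)) = 0"
    have "(u i)^2 \<noteq> 1" using order_chi_le(2)[OF u_nonzero, of i] collide[OF gi] by auto
    then show "poly g (th (u (Suc i))) = 0"
      using g_root_step[OF u_nonzero h_all, of "th (u i)" "Suc i"] gi h_all order_chi_le(1)[OF u_nonzero, of i]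
        double nm[OF u_nonzero h_all] unfolding u_Suc by blast
  qed
  show False
  \<comment> \<open>The pairing either fixes an index, whose eigenvalue would be simple, or
    exchanges two adjacent indices, which then share an eigenvalue.\<close>
  proof (cases "even (j + k)")
    case True
    then obtain m where "j + k = m + m" by (metis evenE mult_2)
    then have "X m * X m = \<nu>^2" using nu2 X_add by metis
    then have "(u m)^2 = 1" using nu by (simp add: u_def power2_eq_square)
    then show False using order_chi_le(2)[OF u_nonzero, of m] collide[OF g_all, of m] by simp
  next
    case False
    then obtain m where "j + k = m + Suc m" by (metis oddE mult_2 add_Suc_right Suc_eq_plus1)
    then have "X m * X (Suc m) = \<nu>^2" using nu2 X_add by metis
    then have "u m * u (Suc m) = 1" using nu by (simp add: u_def power2_eq_square)
    then have "th (u (Suc m) / q^2) = th (u (Suc m))"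
      unfolding u_Suc using th_eq_iff u_nonzero by simp
    then have "marginal (u (Suc m))"
      using marginal_at_reflection[OF u_nonzero] g_all h_all order_chi_le(1)[OF u_nonzero] by simp
    then show False using nm[OF u_nonzero h_all] by simp
  qed
qed

abbreviation e :: "nat \<Rightarrow> nat \<Rightarrow> 'a" where "e \<equiv> evec q a l \<nu> n"

lemma vartheta_u: "vartheta q \<nu> i = th (u i)"
  using powi_X[of i] nu X_nonzero[of i] by (simp add: vartheta_def th_def u_def field_simps)

lemma evec_apply: "e i k = (if k < n then \<Prod>j=Suc k..n-1. th (u i) - \<theta> j else 0)"
proof -
  have "e i k = (\<Sum>h\<in>{1..n}. if h = Suc k then (\<Prod>j=h..n-1. th (u i) - \<theta> j) else 0)"
    unfolding evec_def vartheta_u by (intro sum.cong) auto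
  then show ?thesis by (auto simp: sum.delta)
qed

lemma evec_Wvecs: "e i \<in> Wvecs n"
  by (simp add: Wvecs_def evec_apply)

lemma evec_last: "e i (n - 1) = 1"
  using n_ge by (simp add: evec_apply)

text \<open>At positive indices the products telescope; at index 0 the equation says that
  \<open>th (u i)\<close> is a root of \<open>chi\<close>.\<close>

lemma A_evec: "A (e i) = vscale (th (u i)) (e i)"
proof
  fix k
  define s where "s = th (u i)"
  show "A (e i) k = vscale (th (u i)) (e i) k"
  proof (cases k)
    case 0
    have "{..<n} = insert 0 {Suc 0..n - 1}" using n_ge by auto
    then have "(\<Prod>j<n. s - \<theta> j) = (s - \<theta> 0) * (\<Prod>j=Suc 0..n-1. s - \<theta> j)" by simp
    moreover have "(\<Prod>j<n. s - \<theta> j) = \<delta>" using root_u[of i] by (simp add: poly_chi s_def)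
    ultimately have "(s - \<theta> 0) * e i 0 = \<delta>" using n_ge by (simp add: evec_apply s_def)
    then show ?thesis using 0 n_ge evec_last[of i] by (simp add: actA_def vec_apply s_def algebra_simps)
  next
    case (Suc m)
    show ?thesis
    proof (cases "k < n")
      case True
      then have "{Suc m..n - 1} = insert (Suc m) {Suc (Suc m)..n - 1}" using Suc by auto
      then have "e i m = (s - \<theta> k) * e i k" using Suc True by (simp add: evec_apply s_def)
      then show ?thesis using Suc True by (simp add: actA_def vec_apply s_def algebra_simps)
    qed (simp add: actA_def vec_apply evec_apply)
  qed
qed

text \<open>As the last coordinate of \<open>e i\<close> is 1, \<open>to_poly_A\<close> turns the
  eigenvector equation into a factorisation of \<open>chi\<close>.\<close>

lemma ev_kap: "ev (kap (th (u i))) = e i"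
proof -
  define s where "s = th (u i)"
  have "smult s (to_poly (e i)) = pCons 0 (to_poly (e i)) - chi"
    using to_poly_A[of "e i"] unfolding A_evec to_poly_scale evec_last s_def by simp
  then have "chi = [:- s, 1:] * to_poly (e i)" by (simp add: algebra_simps)
  moreover have "chi = [:- s, 1:] * kap s" using chi_kap root_u s_def by blast
  ultimately have "[:- s, 1:] * kap s = [:- s, 1:] * to_poly (e i)" by metis
  then have "kap s = to_poly (e i)" by (subst (asm) mult_cancel_left) auto
  then show ?thesis using ev_to_poly[OF evec_Wvecs] by (simp add: s_def)
qed

text \<open>A proper nonzero U makes \<open>g\<close> and \<open>h\<close> non-units, so
  \<open>marginal_exists\<close> applies; the root of \<open>h\<close> it provides puts
  \<open>e i\<close> into U.\<close>

lemma reducible_imp_marginal_vector: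
  assumes "W_reducible q a b c l \<delta> n"
  obtains i y \<xi> where "i < n" "y \<noteq> 0" "th y = th (u i)"
    and "A (B (e i)) - vscale (th (y * q^2)) (B (e i)) = vscale \<xi> (e i)"
    and "Bp (n - 1) (e i) 0 = 0"
proof -
  obtain U where U: "W_submodule q a b c l \<delta> n U" "U \<noteq> {0}" "U \<noteq> Wvecs n"
    using assms unfolding W_reducible_def zero_fun_def by blast
  note U' = W_submoduleD[OF U(1)]
  obtain g h where gh: "chi = g * h" and mem: "\<And>p. ev p \<in> U \<longleftrightarrow> g dvd p"
    using submodule_ideal[OF U(1)] by blast
  have D: "g dvd Dop p" if "g dvd p" for p
  proof -
    have "ev p \<in> U" using that mem by blast
    then have "ev (Dop p) \<in> U" unfolding ev_Dop by (rule U'(4))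
    then show ?thesis using mem by blast
  qed
  have g: "\<not> is_unit g"
  proof
    assume "is_unit g"
    then have "ev p \<in> U" for p using mem unit_imp_dvd by blast
    then have "Wvecs n \<subseteq> U" using ev_to_poly by (metis subsetI)
    then show False using U' U(3) by blast
  qed
  have h: "\<not> is_unit h"
  proof
    assume h: "is_unit h"
    have "x = 0" if x: "x \<in> U" for x
    proof -
      have "ev (to_poly x) = x" using x U'(2) ev_to_poly by blast
      moreover from this have "g dvd to_poly x" using mem x by metis
      then have "chi dvd to_poly x" unfolding gh using h by (simp add: mult_unit_dvd_iff)
      ultimately show ?thesis using ev_eq_0_iff by metis
    qed
    then show False using U(2) coords.subspace_0[OF U'(1)] by blast
  qed
  obtain y where y: "y \<noteq> 0" "poly h (th y) = 0" "marginal y"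
    using marginal_exists[OF gh D g h] by blast
  interpret W_ideal q a b c l \<delta> n g h
    by unfold_locales (use gh D in auto)
  have chi0: "poly chi (th y) = 0" using y root_split by simp
  then obtain i where i: "i < n" "th y = th (u i)" using root_chi by blast
  have e_ev: "ev (kap (th y)) = e i" unfolding i by (rule ev_kap)
  have eU: "e i \<in> U" using g_dvd_kap_iff[OF chi0] y mem e_ev by metis
  obtain \<xi> where "chi dvd [:- th (y * q^2), 1:] * Dop (kap (th y)) - smult \<xi> (kap (th y))"
    using y(3) marginal_def by blast
  moreover have "[:- r, 1:] * p = pCons 0 p - smult r p" for r :: 'a and p by simp
  ultimately have "chi dvd pCons 0 (Dop (kap (th y))) - smult (th (y * q^2)) (Dop (kap (th y))) - smult \<xi> (kap (th y))"
    by metis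
  then have marg: "A (B (e i)) - vscale (th (y * q^2)) (B (e i)) = vscale \<xi> (e i)"
    unfolding ev_eq_0_iff[symmetric] by (simp only: ev_diff ev_shift ev_smult ev_Dop e_ev right_minus_eq)
  have BpU: "Bp m (e i) \<in> U" for m
  proof (induction m)
    case (Suc m)
    have "Bp (Suc m) (e i) = B (Bp m (e i)) - vscale (theta_s q b l (n - Suc m)) (Bp m (e i))"
      by (simp add: fun_eq_iff vec_apply)
    then show ?case
      using Suc U'(4) coords.subspace_diff[OF U'(1)] coords.subspace_scale[OF U'(1)] by metis
  qed (simp add: eU)
  \<comment> \<open>Otherwise w_0, which is \<open>ev 1\<close>, lies in U and \<open>g\<close>
    divides 1.\<close>
  have L: "Bp (n - 1) (e i) 0 = 0"
  proof (rule ccontr)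
    define r where "r = Bp (n - 1) (e i) 0"
    assume "Bp (n - 1) (e i) 0 \<noteq> 0"
    then have r: "r \<noteq> 0" by (simp add: r_def)
    have "vscale r (unit_vec 0) \<in> U" using Bp_full[OF evec_Wvecs, of i] BpU r_def by metis
    then have "vscale (1 / r) (vscale r (unit_vec 0)) \<in> U" by (rule coords.subspace_scale[OF U'(1)])
    then have "unit_vec 0 \<in> U" using r by simp
    then have "ev 1 \<in> U" using ev_newton[of 0] n_ge by (simp add: newton_0)
    then show False using mem g by blast
  qed
  show ?thesis by (rule that[OF i(1) y(1) i(2) marg L])
qed

end

section \<open>From the order of \<open>q\<close> to that of \<open>q^2\<close>, and the
  theorem\<close>

text \<open>The orders 1, 2 and 4 are exactly those with d' below 3.\<close>

lemma root_of_unity_order_dprime: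
  assumes "root_of_unity_order (q :: 'a::field) d" "d \<notin> {1, 2, 4}"
  shows "3 \<le> dprime d" "(q^2) ^ dprime d = 1"
    and "\<And>k. 0 < k \<Longrightarrow> k < dprime d \<Longrightarrow> (q^2) ^ k \<noteq> 1"
proof -
  have d: "0 < d" "q ^ d = 1" "\<And>k. 0 < k \<Longrightarrow> k < d \<Longrightarrow> q ^ k \<noteq> 1"
    using assms(1) unfolding root_of_unity_order_def by auto
  show "3 \<le> dprime d"
    using d(1) assms(2) unfolding dprime_def by (auto elim!: oddE evenE)
  show "(q^2) ^ dprime d = 1"
  proof (cases "odd d")
    case True
    then show ?thesis by (simp add: dprime_def d(2) power_mult[symmetric] mult.commute[of 2] power_mult)
  next
    case False
    then show ?thesis by (simp add: dprime_def d(2) flip: power_mult)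
  qed
  fix k assume k: "0 < k" "k < dprime d"
  show "(q^2) ^ k \<noteq> 1"
  proof (cases "2 * k < d")
    case True
    then show ?thesis using d(3)[of "2 * k"] k by (simp flip: power_mult)
  next
    case False
    \<comment> \<open>\<open>2 * k \<ge> d\<close> with \<open>k < dprime d\<close> is possible only
      for odd \<open>d\<close>; then \<open>q ^ (2 * k)\<close> equals
      \<open>q ^ (2 * k - d)\<close>, whose exponent lies strictly between 0 and
      \<open>d\<close>.\<close>
    then have odd: "odd d" "k < d" using k unfolding dprime_def by (auto split: if_splits)
    then have "2 * k \<noteq> d" by auto
    then have "q ^ (2 * k - d) \<noteq> 1" using False odd by (intro d(3)) auto
    moreover have "q ^ (2 * k) = q ^ (2 * k - d) * q ^ d" using False by (simp flip: power_add)
    ultimately show ?thesis using d(2) by (simp add: power_mult)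
  qed
qed

theorem theorem8p9:
  fixes q a b c l \<delta> \<nu> :: "'a::field" and d :: nat
  assumes "alg_closed TYPE('a)"
    and "root_of_unity_order q d" and "d \<notin> {1, 2, 4}"
    and "a \<noteq> 0" and "b \<noteq> 0" and "c \<noteq> 0" and "l \<noteq> 0"
    and "\<nu> \<noteq> 0"
    and "\<nu> ^ dprime d + inverse \<nu> ^ dprime d
           = \<delta> + a ^ dprime d * inverse l ^ dprime d + inverse a ^ dprime d * l ^ dprime d"
  shows "W_reducible q a b c l \<delta> (dprime d) \<longleftrightarrow>
    (\<exists>i < dprime d.
       (\<exists>\<mu>. \<mu> \<noteq> 0
          \<and> actA q a l \<delta> (dprime d) (evec q a l \<nu> (dprime d) i)
              = (\<lambda>k. (\<mu> + inverse \<mu>) * evec q a l \<nu> (dprime d) i k)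
          \<and> evec q a l \<nu> (dprime d) i \<noteq> (\<lambda>_. 0)
          \<and> (\<exists>\<xi>. (\<lambda>k. actA q a l \<delta> (dprime d) (actB q a b c l (dprime d) (evec q a l \<nu> (dprime d) i)) k
                     - (\<mu> * q ^ 2 + inverse \<mu> * inverse q ^ 2)
                       * actB q a b c l (dprime d) (evec q a l \<nu> (dprime d) i) k)
                 = (\<lambda>k. \<xi> * evec q a l \<nu> (dprime d) i k)))
     \<and> Bprod q a b c l (dprime d) (dprime d - 1) (evec q a l \<nu> (dprime d) i) 0 = 0)"
proof -
  define n where "n = dprime d"
  note ord = root_of_unity_order_dprime[OF assms(2,3), folded n_def]
  interpret W_spectrum q a b c l \<delta> n \<nu>
    using assms ord by unfold_locales (auto simp: n_def power_divide field_simps)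
  have th_alt: "th y = y + inverse y" for y :: 'a by (simp add: th_def inverse_eq_divide)
  have th_q2: "th (y * q^2) = y * q ^ 2 + inverse y * inverse q ^ 2" for y :: 'a
    by (simp add: th_alt power_inverse)
  have scale: "(\<lambda>k. r * v k) = vscale r v" for r :: 'a and v by (simp add: vscale_def)
  have diff_scale: "(\<lambda>k. v k - r * w k) = v - vscale r w" for r :: 'a and v w
    by (simp add: fun_eq_iff vec_apply)
  show ?thesis
    unfolding n_def[symmetric] scale diff_scale th_alt[symmetric] th_q2[symmetric] zero_fun_def[symmetric]
  proof
    assume "W_reducible q a b c l \<delta> n"
    then obtain i y \<xi> where i: "i < n" "y \<noteq> 0" "th y = th (u i)"
      "A (B (e i)) - vscale (th (y * q^2)) (B (e i)) = vscale \<xi> (e i)" "Bp (n - 1) (e i) 0 = 0"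
      by (rule reducible_imp_marginal_vector)
    have "e i \<noteq> 0" using evec_last[of i] by (auto simp: vec_apply)
    then show "\<exists>i<n. (\<exists>\<mu>. \<mu> \<noteq> 0 \<and> A (e i) = vscale (th \<mu>) (e i) \<and> e i \<noteq> 0 \<and>
        (\<exists>\<xi>. A (B (e i)) - vscale (th (\<mu> * q^2)) (B (e i)) = vscale \<xi> (e i))) \<and> Bp (n - 1) (e i) 0 = 0"
      using i A_evec[of i] by metis
  next
    assume "\<exists>i<n. (\<exists>\<mu>. \<mu> \<noteq> 0 \<and> A (e i) = vscale (th \<mu>) (e i) \<and> e i \<noteq> 0 \<and>
        (\<exists>\<xi>. A (B (e i)) - vscale (th (\<mu> * q^2)) (B (e i)) = vscale \<xi> (e i))) \<and> Bp (n - 1) (e i) 0 = 0"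
    then obtain i \<mu> \<xi> where "e i \<noteq> 0" "A (e i) = vscale (th \<mu>) (e i)"
      "A (B (e i)) - vscale (th (\<mu> * q^2)) (B (e i)) = vscale \<xi> (e i)" "Bp (n - 1) (e i) 0 = 0"
      by auto
    then show "W_reducible q a b c l \<delta> n"
      by (rule marginal_vector_imp_reducible[OF evec_Wvecs])
  qed
qed

end
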